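(* Let $\mathbb{F}$ be a field, let $m,n$ be positive integers, and let $\underline{d}=(d_1,\ldots,d_m)$ be a list of nonnegative integers with $\max_{1\le i\le m} d_i>0$. Let $M(\lambda)\in\mathbb{F}[\lambda]^{m\times(m+n)}_{\underline{d}}$, let $\alpha_k$ be the number of right minimal indices of $M(\lambda)$ equal to $k$, let $k'=\left\lceil \frac{\sum_{i=1}^m d_i}{n}\right\rceil$, let $t$ be defined by $nk'=\sum_{i=1}^m d_i+t$ (so $0\le t<n$), and let $M_{\underline{d}}$ be the leading row-wise coefficient matrix of $M(\lambda)$. Then the following statements hold. (a) $M(\lambda)$ has full-trimmed-Sylvester-rank if and only if the right minimal indices of $M(\lambda)$ are given by $$\alpha_{k'-1}=t,\qquad \alpha_{k'}=n-t,\qquad\text{and}\qquad \alpha_j=0\ \text{ for } j\notin\{k'-1,k'\}.$$ (b) If $M(\lambda)$ has full-trimmed-Sylvester-rank, then $M(\lambda)$ is a minimal basis with $\operatorname{rank}(M_{\underline{d}})=m$ and with row degrees exactly equal to $d_1,d_2,\ldots,d_m$. (c) If $M(\lambda)$ has full-trimmed-Sylvester-rank, then the degree of any minimal basis dual to $M(\lambda)$ is $k'$.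
   Context: Space: $\mathbb{F}[\lambda]^{m\times(m+n)}_{\underline{d}}$ is the $\mathbb{F}$-linear space of $m\times(m+n)$ polynomial matrices $M(\lambda)$ whose $i$th row has the form $R_i(\lambda)=R_{i,0}+R_{i,1}\lambda+\cdots+R_{i,d_i}\lambda^{d_i}$ with $R_{i,j}\in\mathbb{F}^{1\times(m+n)}$, $i=1,\ldots,m$. The leading row-wise coefficient matrix of $M(\lambda)$ is the $m\times(m+n)$ constant matrix $M_{\underline{d}}$ whose $i$th row is $R_{i,d_i}$. Row degrees are the degrees of the rows; the degree of a polynomial vector or matrix is the highest degree of its entries. Trimmed Sylvester matrices: put $d=\max_i d_i$ and write $M(\lambda)=M_0+M_1\lambda+\cdots+M_d\lambda^d$. For $k\ge1$, the $k$th Sylvester matrix $S_k(M)\in\mathbb{F}^{(k+d)m\times k(m+n)}$ is the block matrix with $k+d$ block rows (indexed $0,\ldots,k+d-1$) and $k$ block columns (indexed $0,\ldots,k-1$) whose $(p,q)$ block is $M_{p-q}$ if $0\le p-q\le d$ and $0$ otherwise. The $k$th trimmed Sylvester matrix $T_k(M)\in\mathbb{F}^{(km+\sum_{i=1}^m d_i)\times k(m+n)}$ is obtained from $S_k(M)$ by deleting, for every $i=1,\ldots,m$, the $i$th row of each of the last $d-d_i$ block rows (these rows are always zero), keeping the order of the remaining rows. $M(\lambda)$ has full-trimmed-Sylvester-rank if $\operatorname{rank} T_k(M)=\min\{km+\sum_{i=1}^m d_i,\;k(m+n)\}$ for all $k=1,2,\ldots$. Minimal bases and indices: a minimal basis of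 a subspace $\mathcal V\subseteq\mathbb{F}(\lambda)^{q}$ is a basis of $\mathcal V$ consisting of polynomial vectors with minimal sum of degrees among all polynomial bases of $\mathcal V$; the ordered list of degrees of the vectors in any minimal basis is the same, and these degrees are the minimal indices of $\mathcal V$. A polynomial matrix with more columns than rows is called a minimal basis if its rows form a minimal basis of the rational subspace they span. The right minimal indices of $M(\lambda)$ are the minimal indices of its right null space over $\mathbb{F}(\lambda)$. Full row rank polynomial matrices $M(\lambda)\in\mathbb{F}[\lambda]^{m\times(m+n)}$ and $N(\lambda)\in\mathbb{F}[\lambda]^{n\times(m+n)}$ are dual minimal bases if both are minimal bases and $M(\lambda)N(\lambda)^T=0$. *)

theory Defs
  imports
    "HOL-Computational_Algebra.Polynomial_Factorial"
    "Jordan_Normal_Form.DL_Rank"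
    "Jordan_Normal_Form.DL_Submatrix"
    "Jordan_Normal_Form.Matrix_Kernel"
begin

text \<open>
  Polynomial matrices over a field are of type \<^typ>\<open>'a poly mat\<close>, and the field of rational
  functions is \<^typ>\<open>'a poly fract\<close>. All indices, including those of row degree lists, start
  at 0.
\<close>

definition poly_mat_space :: "nat list \<Rightarrow> nat \<Rightarrow> nat \<Rightarrow> 'a::field poly mat set" where
  "poly_mat_space d m q =
     {M \<in> carrier_mat m q. \<forall>i<m. \<forall>j<q. degree (M $$ (i, j)) \<le> d ! i}"

definition leading_row_coeff_mat :: "nat list \<Rightarrow> 'a::field poly mat \<Rightarrow> 'a mat" where
  "leading_row_coeff_mat d M =
     mat (dim_row M) (dim_col M) (\<lambda>(i, j). coeff (M $$ (i, j)) (d ! i))"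

text \<open>Degrees are highest degrees of entries; the zero polynomial has degree 0 here.\<close>

definition poly_vec_degree :: "'a::zero poly vec \<Rightarrow> nat" where
  "poly_vec_degree v = Max {degree (v $ i) | i. i < dim_vec v}"

definition poly_mat_degree :: "'a::zero poly mat \<Rightarrow> nat" where
  "poly_mat_degree M = Max {degree (M $$ (i, j)) | i j. i < dim_row M \<and> j < dim_col M}"

definition coeff_mat :: "'a::zero poly mat \<Rightarrow> nat \<Rightarrow> 'a mat" where
  "coeff_mat M l = map_mat (\<lambda>p. coeff p l) M"

text \<open>
  Row \<open>r\<close> of the Sylvester matrix is row \<open>r mod m\<close> of the block row \<open>r div m\<close>, where
  \<open>m\<close> is the number of rows of \<open>M\<close>; likewise for columns.
\<close>

definition sylvester_mat :: "nat list \<Rightarrow> nat \<Rightarrow> 'a::field poly mat \<Rightarrow> 'a mat" where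
  "sylvester_mat d k M =
     (let m = dim_row M; c = dim_col M; e = Max (set d)
      in mat ((k + e) * m) (k * c) (\<lambda>(r, s).
           let p = r div m; q = s div c
           in if q \<le> p \<and> p - q \<le> e then coeff_mat M (p - q) $$ (r mod m, s mod c) else 0))"

text \<open>
  The deleted rows are the \<open>i\<close>-th rows of the last \<open>e - d ! i\<close> of the \<open>k + e\<close> block rows,
  where \<open>e = Max (set d)\<close>.
\<close>

definition trimmed_sylvester_mat :: "nat list \<Rightarrow> nat \<Rightarrow> 'a::field poly mat \<Rightarrow> 'a mat" where
  "trimmed_sylvester_mat d k M =
     (let m = dim_row M; e = Max (set d)
      in submatrix (sylvester_mat d k M)
           (- {r. r div m \<ge> (k + e) - (e - d ! (r mod m))}) UNIV)"

definition full_trimmed_sylvester_rank :: "nat list \<Rightarrow> 'a::field poly mat \<Rightarrow> bool" where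
  "full_trimmed_sylvester_rank d M \<longleftrightarrow>
     (\<forall>k\<ge>1. vec_space.rank (k * dim_row M + sum_list d) (trimmed_sylvester_mat d k M)
            = min (k * dim_row M + sum_list d) (k * dim_col M))"

abbreviation rat_vec :: "'a::field poly vec \<Rightarrow> 'a poly fract vec" where
  "rat_vec \<equiv> map_vec to_fract"

abbreviation rat_mat :: "'a::field poly mat \<Rightarrow> 'a poly fract mat" where
  "rat_mat \<equiv> map_mat to_fract"

text \<open>
  \<open>V\<close> ranges over subspaces of the space of rational vectors of length \<open>q\<close>. Bases are lists,
  so that the rows of a matrix with a repeated row do not count as a basis.
\<close>

definition is_poly_basis ::
    "nat \<Rightarrow> 'a::field poly fract vec set \<Rightarrow> 'a poly vec list \<Rightarrow> bool" where
  "is_poly_basis q V bs \<longleftrightarrow>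
     distinct bs \<and>
     vectorspace.basis class_ring ((module_vec TYPE('a poly fract) q)\<lparr>carrier := V\<rparr>)
       (rat_vec ` set bs)"

definition is_minimal_basis_of ::
    "nat \<Rightarrow> 'a::field poly fract vec set \<Rightarrow> 'a poly vec list \<Rightarrow> bool" where
  "is_minimal_basis_of q V bs \<longleftrightarrow>
     is_poly_basis q V bs \<and>
     (\<forall>cs. is_poly_basis q V cs \<longrightarrow>
        sum_list (map poly_vec_degree bs) \<le> sum_list (map poly_vec_degree cs))"

text \<open>The ordered list of degrees does not depend on the chosen minimal basis.\<close>

definition minimal_indices :: "nat \<Rightarrow> 'a::field poly fract vec set \<Rightarrow> nat list" where
  "minimal_indices q V = sort (map poly_vec_degree (SOME bs. is_minimal_basis_of q V bs))"

definition right_minimal_indices :: "'a::field poly mat \<Rightarrow> nat list" where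
  "right_minimal_indices M = minimal_indices (dim_col M) (mat_kernel (rat_mat M))"

definition is_minimal_basis :: "'a::field poly mat \<Rightarrow> bool" where
  "is_minimal_basis M \<longleftrightarrow>
     dim_row M < dim_col M \<and>
     is_minimal_basis_of (dim_col M) (vec_space.row_space (dim_col M) (rat_mat M)) (rows M)"

definition full_row_rank :: "'a::field poly mat \<Rightarrow> bool" where
  "full_row_rank M \<longleftrightarrow> vec_space.rank (dim_row M) (rat_mat M) = dim_row M"

definition dual_minimal_bases :: "'a::field poly mat \<Rightarrow> 'a poly mat \<Rightarrow> bool" where
  "dual_minimal_bases M N \<longleftrightarrow>
     dim_col N = dim_col M \<and> dim_row M + dim_row N = dim_col M \<and>
     full_row_rank M \<and> full_row_rank N \<and>
     is_minimal_basis M \<and> is_minimal_basis N \<and>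
     M * transpose_mat N = 0\<^sub>m (dim_row M) (dim_row N)"

end

theory Submission imports Defs
begin

text \<open>
  The kernel of the \<open>k\<close>-th trimmed Sylvester matrix of \<open>M\<close> is the space of polynomial vectors of
  degree less than \<open>k\<close> in the right null space of \<open>M\<close>. By the predictable degree property its
  dimension is \<open>\<Sum>\<^sub>i max 0 (k - \<epsilon>\<^sub>i)\<close>, where the \<open>\<epsilon>\<^sub>i\<close> are the right minimal indices. Hence full
  trimmed Sylvester rank says that this sum equals \<open>max 0 (k n - \<sigma>)\<close> for all \<open>k \<ge> 1\<close>, where \<open>\<sigma>\<close> is
  the sum of the \<open>d\<^sub>i\<close>, and taking second differences in \<open>k\<close> yields the multiplicities of the
  indices. The last rows of each index in a trimmed Sylvester matrix form the leading row-wise coefficient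
  matrix padded by zeros, which therefore has full rank. Any polynomial basis of the row space of \<open>M\<close> has
  the same right null space, so counting the rows of its trimmed Sylvester matrices bounds its
  degree sum below by \<open>\<sigma>\<close>; thus \<open>M\<close> is a minimal basis.
\<close>

section \<open>Bases and ranks over a field\<close>

text \<open>Minimality is defined by a sum of degrees over all polynomial bases of a rational
  subspace, so nothing is known beforehand about leading coefficients. The only tool is exchange:
  replacing a basis vector by a polynomial vector in which it occurs cannot lower the sum. Both
  parts of the predictable degree property, polynomial coefficients and degree bounds, are extracted
  from this. To exchange without fractions, a subspace is represented by its polynomial vectors
  (\<open>saturation\<close>), where equations hold up to a nonzero factor.

  The rank formula holds for every minimal basis of the kernel and for matrices of any rank. Hence
  the arbitrary choice in \<open>right_minimal_indices\<close> is harmless, (c) can be read off from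
  the rows of a dual basis, and the formula applies to a matrix built from a competing basis of the
  row space. Since (k' - 1) n < \<sigma> \<le> k' n, the value k = k' is the first one where full
  rank means full row rank. Full row rank of \<open>M\<close> itself comes from counting: t + (n -
  t) = n indices leave rank m.\<close>

lemma sum_image_index:
  fixes f :: "'i \<Rightarrow> 'a::comm_ring_1 vec"
  assumes "inj_on f I"
  shows "(\<Sum>x\<in>f ` I. a x * x $ j) = (\<Sum>i\<in>I. a (f i) * f i $ j)"
  using assms by (simp add: sum.reindex)

context vec_space
begin

lemma submodule_vs:
  assumes W: "submodule class_ring W V"
  shows "vectorspace class_ring (V\<lparr>carrier := W\<rparr>)"
  using submodule_is_module[OF W] class_field by (simp add: vectorspace_def)

lemma basis_submodule_iff:
  assumes W: "submodule class_ring W V" and S: "S \<subseteq> W"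
  shows "vectorspace.basis class_ring (V\<lparr>carrier := W\<rparr>) S \<longleftrightarrow> lin_indpt S \<and> span S = W"
proof -
  have vs: "vectorspace class_ring (vs W)"
    by (rule submodule_vs[OF W])
  show ?thesis
    unfolding vectorspace.basis_def[OF vs]
    using span_li_not_depend[OF S W] S by simp
qed

text \<open>Equal members at two indices would satisfy the relation with coefficients 1 and -1, so
  independence of an indexed family also excludes repetitions.\<close>

lemma indep_family:
  assumes fin: "finite I" and fc: "f ` I \<subseteq> carrier_vec n"
    and ind: "\<And>c. \<forall>j<n. (\<Sum>i\<in>I. c i * f i $ j) = 0 \<Longrightarrow> \<forall>i\<in>I. c i = 0"
  shows "inj_on f I" and "lin_indpt (f ` I)"
proof -
  have finI: "finite (f ` I)" using fin by simp
  show inj: "inj_on f I"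
  proof (rule inj_onI, rule ccontr)
    fix x y assume xy: "x \<in> I" "y \<in> I" "f x = f y" "x \<noteq> y"
    define c :: "'b \<Rightarrow> 'a" where "c = (\<lambda>i. if i = x then 1 else if i = y then -1 else 0)"
    have "(\<Sum>i\<in>I. c i * f i $ j) = 0" for j
    proof -
      have "(\<Sum>i\<in>I. c i * f i $ j) = (\<Sum>i\<in>{x,y}. c i * f i $ j)"
        by (rule sum.mono_neutral_right[OF fin]) (use xy in \<open>auto simp: c_def\<close>)
      also have "\<dots> = 0" using xy by (simp add: c_def)
      finally show ?thesis .
    qed
    then have "\<forall>i\<in>I. c i = 0" by (intro ind) simp
    then have "c x = 0" using xy(1) by blast
    then show False by (simp add: c_def)
  qed
  show "lin_indpt (f ` I)"
  proof (rule finite_lin_indpt2[OF finI])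
    show "f ` I \<subseteq> carrier_vec n" using fc by simp
    fix a assume a: "lincomb a (f ` I) = 0\<^sub>v n"
    have "(\<Sum>i\<in>I. a (f i) * f i $ j) = 0" if "j < n" for j
      unfolding sum_image_index[OF inj, symmetric] lincomb_index[OF that fc, symmetric] a
      using that by simp
    then have "\<forall>i\<in>I. a (f i) = 0"
      by (intro ind) simp
    then show "\<forall>v\<in>f ` I. a v = 0" by simp
  qed
qed

text \<open>The interface between the library, where a basis is a set inside a structure with
  modified carrier, and coordinatewise equations for families. Injectivity keeps repeated members
  from disappearing in the image set.\<close>

lemma basis_family_iff:
  assumes fin: "finite I" and W: "submodule class_ring W V"
  shows "inj_on f I \<and> vectorspace.basis class_ring (V\<lparr>carrier := W\<rparr>) (f ` I) \<longleftrightarrow>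
    f ` I \<subseteq> W \<and> (\<forall>c. (\<forall>j<n. (\<Sum>i\<in>I. c i * f i $ j) = 0) \<longrightarrow> (\<forall>i\<in>I. c i = 0)) \<and>
    (\<forall>v\<in>W. \<exists>c. \<forall>j<n. v $ j = (\<Sum>i\<in>I. c i * f i $ j))" (is "?L \<longleftrightarrow> ?sub \<and> ?ind \<and> ?gen")
proof -
  have Wc: "W \<subseteq> carrier_vec n" using W unfolding submodule_def by auto
  have finI: "finite (f ` I)" using fin by simp
  have vs: "vectorspace class_ring (vs W)"
    by (rule submodule_vs[OF W])
  show ?thesis
  proof
    assume L: ?L
    then have inj: "inj_on f I" by blast
    have sub: ?sub using L unfolding vectorspace.basis_def[OF vs] by simp
    then have fc: "f ` I \<subseteq> carrier_vec n" using Wc by blast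
    have li: "lin_indpt (f ` I)" and sp: "span (f ` I) = W"
      using L basis_submodule_iff[OF W sub] by blast+
    have ?ind
    proof (intro allI impI)
      fix c assume c: "\<forall>j<n. (\<Sum>i\<in>I. c i * f i $ j) = 0"
      define a where "a = (\<lambda>x. c (the_inv_into I f x))"
      have af: "a (f i) = c i" if "i \<in> I" for i
        using that inj by (simp add: a_def the_inv_into_f_f)
      have "lincomb a (f ` I) = 0\<^sub>v n"
      proof (rule eq_vecI)
        fix j assume "j < dim_vec (0\<^sub>v n)"
        then have j: "j < n" by simp
        have "lincomb a (f ` I) $ j = (\<Sum>i\<in>I. a (f i) * f i $ j)"
          by (simp add: lincomb_index[OF j fc] sum_image_index[OF inj])
        also have "\<dots> = (\<Sum>i\<in>I. c i * f i $ j)" by (rule sum.cong) (auto simp: af)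
        finally show "lincomb a (f ` I) $ j = 0\<^sub>v n $ j" using c j by simp
      qed (simp add: lincomb_dim[OF finI fc])
      then have "a x = 0" if "x \<in> f ` I" for x
        using li lin_dep_crit[OF finI subset_refl _ that, of a] by simp blast
      then show "\<forall>i\<in>I. c i = 0" using af by simp
    qed
    moreover have ?gen
    proof
      fix v assume "v \<in> W"
      then obtain a where a: "lincomb a (f ` I) = v"
        using finite_in_span[OF finI, of v] fc sp by metis
      have "v $ j = (\<Sum>i\<in>I. a (f i) * f i $ j)" if "j < n" for j
        using lincomb_index[OF that fc, of a] a by (simp add: sum_image_index[OF inj])
      then show "\<exists>c. \<forall>j<n. v $ j = (\<Sum>i\<in>I. c i * f i $ j)"
        by (intro exI[of _ "\<lambda>i. a (f i)"]) simp
    qed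
    ultimately show "?sub \<and> ?ind \<and> ?gen" using sub by blast
  next
    assume R: "?sub \<and> ?ind \<and> ?gen"
    then have sub: ?sub and ind: ?ind and gen: ?gen by blast+
    have fc: "f ` I \<subseteq> carrier_vec n" using Wc sub by blast
    have inj: "inj_on f I" and "lin_indpt (f ` I)"
      using indep_family[OF fin fc] ind by blast+
    moreover have "span (f ` I) = W"
    proof
      show "span (f ` I) \<subseteq> W" using span_is_subset[OF sub W] .
      show "W \<subseteq> span (f ` I)"
      proof
        fix v assume v: "v \<in> W"
        then obtain c where c: "\<forall>j<n. v $ j = (\<Sum>i\<in>I. c i * f i $ j)" using gen by blast
        define a where "a = (\<lambda>x. c (the_inv_into I f x))"
        have af: "a (f i) = c i" if "i \<in> I" for i
          using that inj by (simp add: a_def the_inv_into_f_f)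
        have "v = lincomb a (f ` I)"
        proof (rule eq_vecI)
          show "dim_vec v = dim_vec (lincomb a (f ` I))" using v Wc lincomb_dim[OF finI fc] by auto
          fix j assume "j < dim_vec (lincomb a (f ` I))"
          then have j: "j < n" by (simp add: lincomb_dim[OF finI fc])
          have "lincomb a (f ` I) $ j = (\<Sum>i\<in>I. a (f i) * f i $ j)"
            by (simp add: lincomb_index[OF j fc] sum_image_index[OF inj])
          also have "\<dots> = (\<Sum>i\<in>I. c i * f i $ j)" by (rule sum.cong) (auto simp: af)
          finally show "v $ j = lincomb a (f ` I) $ j" using c j by simp
        qed
        then show "v \<in> span (f ` I)" unfolding span_def using finI by blast
      qed
    qed
    ultimately show ?L using inj basis_submodule_iff[OF W sub] by blast
  qed
qed

lemma dim_submodule_family: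
  assumes "finite I" "submodule class_ring W V" "f ` I \<subseteq> W"
    and "\<And>c. (\<And>j. j < n \<Longrightarrow> (\<Sum>i\<in>I. c i * f i $ j) = 0) \<Longrightarrow> \<forall>i\<in>I. c i = 0"
    and "\<And>v. v \<in> W \<Longrightarrow> \<exists>c. \<forall>j<n. v $ j = (\<Sum>i\<in>I. c i * f i $ j)"
  shows "vectorspace.dim class_ring (V\<lparr>carrier := W\<rparr>) = card I"
proof -
  have vs: "vectorspace class_ring (vs W)"
    by (rule submodule_vs[OF assms(2)])
  have "inj_on f I \<and> vectorspace.basis class_ring (V\<lparr>carrier := W\<rparr>) (f ` I)"
    using basis_family_iff[OF assms(1,2), of f] assms(3-5) by blast
  then show ?thesis
    using vectorspace.dim_basis[OF vs, of "f ` I"] assms(1) by (simp add: card_image)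
qed

lemma rank_nullity_mat:
  assumes A: "A \<in> carrier_mat n nc"
  shows "rank A + vectorspace.dim class_ring ((module_vec TYPE('a) nc)\<lparr>carrier := mat_kernel A\<rparr>) = nc"
proof -
  interpret D: vec_space "TYPE('a)" nc .
  have hom: "(\<lambda>v. A *\<^sub>v v) \<in> LinearCombinations.module_hom class_ring (module_vec TYPE('a) nc) V"
    unfolding LinearCombinations.module_hom_def module_vec_simps class_ring_simps
    using A mult_add_distrib_mat_vec[OF A] mult_mat_vec[OF A] by simp
  interpret L: linear_map class_ring "module_vec TYPE('a) nc" V "\<lambda>v. A *\<^sub>v v"
    by (intro linear_map.intro mod_hom.intro mod_hom_axioms.intro vec_vs vec_module hom)
  have im: "L.im = span (set (cols A))"
    using col_space_eq[OF A] A unfolding L.im_def col_space_def by (auto simp: module_vec_simps)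
  have ker: "L.ker = mat_kernel A"
    using A unfolding L.ker_def mat_kernel_def by (auto simp: module_vec_simps)
  show ?thesis
    using L.rank_nullity[OF D.fin_dim] unfolding im ker D.dim_is_n rank_def by simp
qed

lemma rank_le_nr:
  assumes A: "A \<in> carrier_mat n nc"
  shows "rank A \<le> n"
proof -
  have S: "set (cols A) \<subseteq> carrier_vec n" using A cols_dim[of A] by simp
  have "vectorspace.fin_dim class_ring (span_vs (set (cols A)))"
    using fin_dim_span[of "set (cols A)"] S by simp
  then show ?thesis
    unfolding rank_def using subspace_dim[OF span_is_subspace[OF S] fin_dim] dim_is_n by simp
qed

text \<open>Surjectivity is the form in which full row rank is passed from a trimmed Sylvester
  matrix to the leading coefficient matrix, and it supplies preimages of unit vectors.\<close>

lemma rank_eq_nr_iff: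
  assumes A: "A \<in> carrier_mat n nc"
  shows "rank A = n \<longleftrightarrow> (\<forall>y\<in>carrier_vec n. \<exists>x\<in>carrier_vec nc. A *\<^sub>v x = y)"
proof -
  have S: "set (cols A) \<subseteq> carrier_vec n" using A cols_dim[of A] by simp
  have sub: "submodule class_ring (span (set (cols A))) V" by (rule span_is_submodule[OF S])
  have vs: "vectorspace class_ring (vs (span (set (cols A))))"
    by (rule submodule_vs[OF sub])
  have "rank A = n \<longleftrightarrow> span (set (cols A)) = carrier_vec n"
  proof
    assume r: "rank A = n"
    have "vectorspace.fin_dim class_ring (span_vs (set (cols A)))"
      using fin_dim_span[of "set (cols A)"] S by simp
    then obtain B where B: "finite B" "vectorspace.basis class_ring (vs (span (set (cols A)))) B"
      using vectorspace.finite_basis_exists[OF vs] by blast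
    then have BS: "B \<subseteq> span (set (cols A))" unfolding vectorspace.basis_def[OF vs] by simp
    have li: "lin_indpt B" and sp: "span B = span (set (cols A))"
      using B(2) unfolding basis_submodule_iff[OF sub BS] by blast+
    have "card B = n" using vectorspace.dim_basis[OF vs B] r unfolding rank_def by simp
    moreover have Bc: "B \<subseteq> carrier_vec n"
      using BS span_is_subset2[OF S] by (rule subset_trans)
    ultimately have "basis B" using dim_li_is_basis[OF fin_dim B(1) Bc li] dim_is_n by simp
    then show "span (set (cols A)) = carrier_vec n" using sp unfolding basis_def by simp
  next
    assume sp: "span (set (cols A)) = carrier_vec n"
    have "V\<lparr>carrier := carrier_vec n\<rparr> = V" unfolding module_vec_def by simp
    then show "rank A = n" unfolding rank_def sp by (simp only: dim_is_n)
  qed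
  also have "\<dots> \<longleftrightarrow> (\<forall>y\<in>carrier_vec n. \<exists>x\<in>carrier_vec nc. A *\<^sub>v x = y)"
  proof -
    have "span (set (cols A)) = {y \<in> carrier_vec n. \<exists>x\<in>carrier_vec nc. A *\<^sub>v x = y}"
      using col_space_eq[OF A] A unfolding col_space_def by simp
    then show ?thesis by blast
  qed
  finally show ?thesis .
qed

end

lemma mat_kernel_submodule:
  fixes A :: "'a::field mat"
  assumes A: "A \<in> carrier_mat nr nc"
  shows "submodule class_ring (mat_kernel A) (module_vec TYPE('a) nc)"
  unfolding submodule_def module_vec_simps class_ring_simps
proof (intro conjI allI impI)
  fix v w :: "'a vec" assume vw: "v \<in> mat_kernel A" "w \<in> mat_kernel A"
  have "A *\<^sub>v (v + w) = 0\<^sub>v nr"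
    using mat_kernelD[OF A vw(1)] mat_kernelD[OF A vw(2)] by (simp add: mult_add_distrib_mat_vec[OF A])
  then show "v + w \<in> mat_kernel A"
    using mat_kernelD(1)[OF A vw(1)] mat_kernelD(1)[OF A vw(2)] by (intro mat_kernelI[OF A]) simp_all
next
  fix c and v :: "'a vec" assume "v \<in> mat_kernel A"
  then show "c \<cdot>\<^sub>v v \<in> mat_kernel A" by (rule mat_kernel_smult[OF A])
next
  have "A *\<^sub>v 0\<^sub>v nc = 0\<^sub>v nr" using A by (intro eq_vecI) auto
  then show "0\<^sub>v nc \<in> mat_kernel A" by (intro mat_kernelI[OF A]) simp_all
next
  show "Module.module class_ring (module_vec TYPE('a) nc)" by (rule vec_module)
next
  show "mat_kernel A \<subseteq> carrier_vec nc" by (rule mat_kernel_carrier[OF A])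
qed

section \<open>Polynomial bases of rational subspaces\<close>

definition lin_comb :: "(nat \<Rightarrow> 'a::comm_ring_1) \<Rightarrow> 'a vec list \<Rightarrow> nat \<Rightarrow> 'a" where
  "lin_comb c ws j = (\<Sum>i<length ws. c i * ws ! i $ j)"

text \<open>Coefficients range over the ring itself. For polynomial vectors this agrees with
  independence over the rational functions, because a rational relation becomes polynomial after
  clearing denominators.\<close>

definition lin_indep :: "nat \<Rightarrow> 'a::comm_ring_1 vec list \<Rightarrow> bool" where
  "lin_indep q ws \<longleftrightarrow> (\<forall>c. (\<forall>j<q. lin_comb c ws j = 0) \<longrightarrow> (\<forall>i<length ws. c i = 0))"

text \<open>The polynomial vectors in the rational span of \<open>ws\<close>, described without fractions.\<close>

definition saturation :: "nat \<Rightarrow> 'a::comm_ring_1 vec list \<Rightarrow> 'a vec set" where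
  "saturation q ws = {v \<in> carrier_vec q. \<exists>s c. s \<noteq> 0 \<and> (\<forall>j<q. s * v $ j = lin_comb c ws j)}"

definition poly_part :: "nat \<Rightarrow> 'a::field poly fract vec set \<Rightarrow> 'a poly vec set" where
  "poly_part q V = {v \<in> carrier_vec q. rat_vec v \<in> V}"

lemma lin_indepD:
  assumes "lin_indep q ws" "\<And>j. j < q \<Longrightarrow> lin_comb c ws j = 0" "i < length ws"
  shows "c i = 0"
  using assms unfolding lin_indep_def by blast

lemma to_fract_sum: "to_fract (sum f A) = (\<Sum>i\<in>A. to_fract (f i))"
  by (induction A rule: infinite_finite_induct) (simp_all add: to_fract_add)

lemma to_fract_lin_comb:
  assumes "set ws \<subseteq> carrier_vec q" "j < q"
  shows "to_fract (lin_comb c ws j) = (\<Sum>i<length ws. to_fract (c i) * map_vec to_fract (ws ! i) $ j)"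
proof -
  have "dim_vec (ws ! i) = q" if "i < length ws" for i
    using assms(1) that nth_mem by fastforce
  then show ?thesis
    using assms(2) by (simp add: lin_comb_def to_fract_sum to_fract_mult)
qed

text \<open>Induction multiplies the denominator found so far by that of the new entry. Every
  passage from rational to polynomial coefficients goes through this single factor.\<close>

lemma common_denominator:
  fixes c :: "nat \<Rightarrow> 'a::idom fract"
  shows "\<exists>s p. s \<noteq> 0 \<and> (\<forall>i<r. to_fract s * c i = to_fract (p i))"
proof (induction r)
  case 0
  show ?case by (intro exI[of _ 1]) simp
next
  case (Suc r)
  then obtain s p where s: "s \<noteq> 0" "\<And>i. i < r \<Longrightarrow> to_fract s * c i = to_fract (p i)" by blast
  obtain a b where ab: "c r = Fract a b" "b \<noteq> 0" by (cases "c r") auto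
  have "to_fract b * c r = to_fract a" using ab by (simp add: to_fract_def eq_fract)
  then have "to_fract (s * b) * c i = to_fract (if i = r then s * a else b * p i)" if "i < Suc r" for i
    using that s(2)[of i] by (auto simp: to_fract_mult mult_ac less_Suc_eq)
  then show ?case using s(1) ab(2)
    by (intro exI[of _ "s * b"] exI[of _ "\<lambda>i. if i = r then s * a else b * p i"]) auto
qed

lemma lin_comb_unit:
  assumes "i < length ws"
  shows "lin_comb (\<lambda>k. if k = i then 1 else 0) ws j = ws ! i $ j"
  using assms by (simp add: lin_comb_def if_distrib[of "\<lambda>x. x * _"] sum.delta cong: if_cong)

lemma set_subset_saturation:
  assumes "set ws \<subseteq> carrier_vec q"
  shows "set ws \<subseteq> saturation q ws"
proof
  fix w assume w: "w \<in> set ws"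
  then obtain i where "i < length ws" "w = ws ! i" by (auto simp: in_set_conv_nth)
  then show "w \<in> saturation q ws"
    using assms w unfolding saturation_def
    by (auto intro!: exI[of _ 1] exI[of _ "\<lambda>k. if k = i then 1 else 0"] simp: lin_comb_unit)
qed

lemma (in vec_space) submodule_sum_mem:
  assumes W: "submodule class_ring W V" and "finite I" "\<And>i. i \<in> I \<Longrightarrow> f i \<in> W"
  shows "vec n (\<lambda>j. \<Sum>i\<in>I. c i * f i $ j) \<in> W"
  using assms(2,3)
proof (induction I rule: finite_induct)
  case empty
  have "0\<^sub>v n \<in> W" using submodule.zero_closed[OF W] by simp
  then show ?case by (simp add: zero_vec_def)
next
  case (insert x I)
  have fx: "f x \<in> W" using insert by blast
  then have fxc: "f x \<in> carrier_vec n" using submodule.subset[OF W] by auto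
  have "c x \<cdot>\<^sub>v f x \<in> W" using submodule.smult_closed[OF W _ fx, of "c x"] by simp
  moreover have "vec n (\<lambda>j. \<Sum>i\<in>I. c i * f i $ j) \<in> W" using insert by blast
  ultimately have "c x \<cdot>\<^sub>v f x + vec n (\<lambda>j. \<Sum>i\<in>I. c i * f i $ j) \<in> W"
    using submodule.m_closed[OF W] by simp
  moreover have "c x \<cdot>\<^sub>v f x + vec n (\<lambda>j. \<Sum>i\<in>I. c i * f i $ j) = vec n (\<lambda>j. \<Sum>i\<in>insert x I. c i * f i $ j)"
    using insert(1,2) fxc by (intro eq_vecI) simp_all
  ultimately show ?case by simp
qed

lemma map_vec_to_fract_inj: "map_vec to_fract v = map_vec to_fract w \<longleftrightarrow> v = w"
  by (metis index_map_vec to_fract_eq_iff vec_eq_iff)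

lemma is_poly_basis_family:
  "is_poly_basis q W bs \<longleftrightarrow> inj_on (\<lambda>i. rat_vec (bs ! i)) {..<length bs} \<and>
    vectorspace.basis class_ring ((module_vec TYPE('a::field poly fract) q)\<lparr>carrier := W\<rparr>)
      ((\<lambda>i. rat_vec (bs ! i)) ` {..<length bs})"
proof -
  have "(\<lambda>i. rat_vec (bs ! i)) ` {..<length bs} = rat_vec ` set bs"
    unfolding set_conv_nth by blast
  moreover have "inj_on (\<lambda>i. rat_vec (bs ! i)) {..<length bs} \<longleftrightarrow> distinct bs"
    unfolding inj_on_def map_vec_to_fract_inj distinct_conv_nth by auto
  ultimately show ?thesis unfolding is_poly_basis_def by simp
qed

text \<open>Eliminates the fraction field: a common denominator makes a rational combination
  polynomial, and the nonzero multiplier in \<open>saturation\<close> absorbs it. Afterwards minimal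
  bases are treated over the polynomial ring alone.\<close>

lemma is_poly_basis_iff:
  fixes V :: "'a::field poly fract vec set"
  assumes V: "submodule class_ring V (module_vec TYPE('a poly fract) q)"
  shows "is_poly_basis q V bs \<longleftrightarrow>
    set bs \<subseteq> carrier_vec q \<and> lin_indep q bs \<and> saturation q bs = poly_part q V"
proof -
  interpret vec_space "TYPE('a poly fract)" q .
  have Vc: "V \<subseteq> carrier_vec q" using submodule.subset[OF V] by (simp only: module_vec_simps)
  define I where "I = {..<length bs}"
  define f where "f = (\<lambda>i. rat_vec (bs ! i))"
  have fin: "finite I" by (simp add: I_def)
  have iff: "is_poly_basis q V bs \<longleftrightarrow>
    f ` I \<subseteq> V \<and> (\<forall>c. (\<forall>j<q. (\<Sum>i\<in>I. c i * f i $ j) = 0) \<longrightarrow> (\<forall>i\<in>I. c i = 0)) \<and>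
    (\<forall>v\<in>V. \<exists>c. \<forall>j<q. v $ j = (\<Sum>i\<in>I. c i * f i $ j))" (is "_ \<longleftrightarrow> ?sub \<and> ?ind \<and> ?gen")
    unfolding is_poly_basis_family using basis_family_iff[OF fin V, of f] unfolding I_def f_def .
  have lc: "to_fract (lin_comb c bs j) = (\<Sum>i\<in>I. to_fract (c i) * f i $ j)"
    if "set bs \<subseteq> carrier_vec q" "j < q" for c j
    using to_fract_lin_comb[OF that, of c] by (simp add: I_def f_def)
  show ?thesis unfolding iff
  proof
    assume "?sub \<and> ?ind \<and> ?gen"
    then have sub: ?sub and ind: ?ind and gen: ?gen by blast+
    have bc: "set bs \<subseteq> carrier_vec q"
    proof
      fix b assume "b \<in> set bs"
      then obtain i where i: "i < length bs" "b = bs ! i" by (auto simp: in_set_conv_nth)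
      have "f i \<in> V" using sub i(1) by (auto simp: I_def)
      then have "rat_vec b \<in> carrier_vec q" using Vc i(2) by (auto simp: f_def)
      then show "b \<in> carrier_vec q" by simp
    qed
    have "lin_indep q bs"
      unfolding lin_indep_def
    proof (intro allI impI)
      fix c i assume c: "\<forall>j<q. lin_comb c bs j = 0" and i: "i < length bs"
      have "(\<Sum>i\<in>I. to_fract (c i) * f i $ j) = 0" if "j < q" for j
        using lc[OF bc that, of c] c that by simp
      then have "\<forall>i\<in>I. to_fract (c i) = 0" by (intro ind[THEN spec, THEN mp]) simp
      then show "c i = 0" using i by (simp add: I_def)
    qed
    moreover have "saturation q bs = poly_part q V"
    proof
      show "poly_part q V \<subseteq> saturation q bs"
      proof
        fix v assume "v \<in> poly_part q V"
        then have v: "v \<in> carrier_vec q" "rat_vec v \<in> V" by (auto simp: poly_part_def)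
        obtain c where c: "\<And>j. j < q \<Longrightarrow> rat_vec v $ j = (\<Sum>i\<in>I. c i * f i $ j)"
          using gen v(2) by blast
        obtain s p where s: "s \<noteq> 0" and p: "\<And>i. i < length bs \<Longrightarrow> to_fract s * c i = to_fract (p i)"
          using common_denominator[of "length bs" c] by blast
        have "s * v $ j = lin_comb p bs j" if j: "j < q" for j
        proof -
          have "to_fract (s * v $ j) = to_fract s * rat_vec v $ j" using v j by (simp add: to_fract_mult)
          also have "\<dots> = (\<Sum>i\<in>I. to_fract s * c i * f i $ j)"
            unfolding c[OF j] by (simp add: sum_distrib_left mult.assoc)
          also have "\<dots> = (\<Sum>i\<in>I. to_fract (p i) * f i $ j)"
            by (rule sum.cong) (simp_all add: I_def p)
          finally have "to_fract (s * v $ j) = to_fract (lin_comb p bs j)" unfolding lc[OF bc j] .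
          then show ?thesis unfolding to_fract_eq_iff .
        qed
        then show "v \<in> saturation q bs" using v s unfolding saturation_def by blast
      qed
      show "saturation q bs \<subseteq> poly_part q V"
      proof
        fix v assume "v \<in> saturation q bs"
        then obtain s p where v: "v \<in> carrier_vec q" and s: "s \<noteq> 0"
          and p: "\<And>j. j < q \<Longrightarrow> s * v $ j = lin_comb p bs j" unfolding saturation_def by blast
        have "rat_vec v $ j = (\<Sum>i\<in>I. to_fract (p i) / to_fract s * f i $ j)" if j: "j < q" for j
        proof -
          have "to_fract s * rat_vec v $ j = to_fract (s * v $ j)" using v j by (simp add: to_fract_mult)
          also have "\<dots> = (\<Sum>i\<in>I. to_fract (p i) * f i $ j)" unfolding p[OF j] lc[OF bc j] ..
          finally have "rat_vec v $ j = (\<Sum>i\<in>I. to_fract (p i) * f i $ j) / to_fract s"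
            using s by (simp add: field_simps)
          then show ?thesis by (simp add: sum_divide_distrib)
        qed
        then have "rat_vec v = vec q (\<lambda>j. \<Sum>i\<in>I. to_fract (p i) / to_fract s * f i $ j)"
          using v by (intro eq_vecI) simp_all
        also have "\<dots> \<in> V" using sub by (intro submodule_sum_mem[OF V fin]) blast
        finally show "v \<in> poly_part q V" using v by (simp add: poly_part_def)
      qed
    qed
    ultimately show "set bs \<subseteq> carrier_vec q \<and> lin_indep q bs \<and> saturation q bs = poly_part q V"
      using bc by blast
  next
    assume "set bs \<subseteq> carrier_vec q \<and> lin_indep q bs \<and> saturation q bs = poly_part q V"
    then have bc: "set bs \<subseteq> carrier_vec q" and ind: "lin_indep q bs"
      and sat: "saturation q bs = poly_part q V" by blast+
    have ?sub
    proof
      fix x assume "x \<in> f ` I"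
      then obtain i where i: "i < length bs" and x: "x = rat_vec (bs ! i)" by (auto simp: I_def f_def)
      have "bs ! i \<in> poly_part q V" using set_subset_saturation[OF bc] nth_mem[OF i] unfolding sat by blast
      then show "x \<in> V" by (simp add: poly_part_def x)
    qed
    moreover have ?ind
    proof (intro allI impI ballI)
      fix c i assume c: "\<forall>j<q. (\<Sum>i\<in>I. c i * f i $ j) = 0" and i: "i \<in> I"
      obtain s p where s: "s \<noteq> 0" and p: "\<And>i. i < length bs \<Longrightarrow> to_fract s * c i = to_fract (p i)"
        using common_denominator[of "length bs" c] by blast
      have "lin_comb p bs j = 0" if j: "j < q" for j
      proof -
        have "to_fract (lin_comb p bs j) = (\<Sum>i\<in>I. to_fract s * (c i * f i $ j))"
          unfolding lc[OF bc j] by (rule sum.cong) (simp_all add: I_def p[symmetric] mult.assoc)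
        also have "\<dots> = 0" using c j by (simp add: sum_distrib_left[symmetric])
        finally show ?thesis by simp
      qed
      then have "p i = 0" using lin_indepD[OF ind, of p i] i by (simp add: I_def)
      then show "c i = 0" using p[of i] s i by (simp add: I_def)
    qed
    moreover have ?gen
    proof
      fix v assume v: "v \<in> V"
      \<comment> \<open>Two factors get cleared: \<open>s\<close> makes \<open>v\<close> polynomial,
        and \<open>s'\<close> below comes from membership of the result in the saturation.\<close>
      obtain s w where s: "s \<noteq> 0" and w: "\<And>j. j < q \<Longrightarrow> to_fract s * v $ j = to_fract (w j)"
        using common_denominator[of q "\<lambda>j. v $ j"] by blast
      have "rat_vec (vec q w) = to_fract s \<cdot>\<^sub>v v"
        using v Vc w by (intro eq_vecI) auto
      also have "\<dots> \<in> V" using submodule.smult_closed[OF V _ v, of "to_fract s"] by simp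
      finally have "vec q w \<in> saturation q bs" unfolding sat poly_part_def by simp
      then obtain s' p where s': "s' \<noteq> 0" and p: "\<And>j. j < q \<Longrightarrow> s' * w j = lin_comb p bs j"
        unfolding saturation_def by auto
      have "v $ j = (\<Sum>i\<in>I. to_fract (p i) / to_fract (s * s') * f i $ j)" if j: "j < q" for j
      proof -
        have "to_fract (s * s') * v $ j = to_fract (s' * w j)"
          using w[OF j] by (simp add: to_fract_mult mult_ac)
        also have "\<dots> = (\<Sum>i\<in>I. to_fract (p i) * f i $ j)" unfolding p[OF j] lc[OF bc j] ..
        finally have "v $ j = (\<Sum>i\<in>I. to_fract (p i) * f i $ j) / to_fract (s * s')"
          using s s' by (simp add: field_simps)
        then show ?thesis by (simp add: sum_divide_distrib)
      qed
      then show "\<exists>c. \<forall>j<q. v $ j = (\<Sum>i\<in>I. c i * f i $ j)"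
        by (intro exI[of _ "\<lambda>i. to_fract (p i) / to_fract (s * s')"]) simp
    qed
    ultimately show "?sub \<and> ?ind \<and> ?gen" by blast
  qed
qed

section \<open>Minimal bases\<close>

text \<open>The first identity substitutes the given expansion for the new vector. The second solves
  the expansion for \<open>p k\<close> times the old vector, hence the factor \<open>p k\<close> on
  its left side.\<close>

lemma lin_comb_update:
  fixes ws :: "'a::idom vec list"
  assumes w: "s * w $ j = lin_comb p ws j" and k: "k < length ws"
  shows "s * lin_comb c (ws[k := w]) j =
      lin_comb (\<lambda>i. (if i = k then 0 else s * c i) + c k * p i) ws j"
    and "p k * lin_comb c ws j =
      lin_comb (\<lambda>i. if i = k then c k * s else p k * c i - c k * p i) (ws[k := w]) j"
proof -
  have split: "lin_comb a vs j = a k * vs ! k $ j + (\<Sum>i\<in>{..<length ws} - {k}. a i * vs ! i $ j)"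
    if "length vs = length ws" for a and vs :: "'a vec list"
    using k that by (simp add: lin_comb_def sum.remove[of "{..<length ws}" k])
  let ?S = "\<lambda>f. \<Sum>i\<in>{..<length ws} - {k}. f i * ws ! i $ j"
  have rest: "(\<Sum>i\<in>{..<length ws} - {k}. a i * ws[k := w] ! i $ j) = ?S a" for a
    by (rule sum.cong) auto
  have w': "s * w $ j = p k * ws ! k $ j + ?S p" using w by (simp add: split)
  have L: "lin_comb a (ws[k := w]) j = a k * w $ j + ?S a" for a
    using k by (simp add: split rest)
  have "?S (\<lambda>i. (if i = k then 0 else s * c i) + c k * p i) = ?S (\<lambda>i. s * c i + c k * p i)"
    by (rule sum.cong) auto
  also have "\<dots> = s * ?S c + c k * ?S p"
    by (simp add: sum.distrib sum_distrib_left algebra_simps)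
  finally have "lin_comb (\<lambda>i. (if i = k then 0 else s * c i) + c k * p i) ws j
      = c k * p k * ws ! k $ j + (s * ?S c + c k * ?S p)"
    by (simp add: split)
  also have "\<dots> = c k * (s * w $ j) + s * ?S c" unfolding w' by (simp add: algebra_simps)
  finally show "s * lin_comb c (ws[k := w]) j =
      lin_comb (\<lambda>i. (if i = k then 0 else s * c i) + c k * p i) ws j"
    unfolding L by (simp add: algebra_simps)
  have "?S (\<lambda>i. if i = k then c k * s else p k * c i - c k * p i) = ?S (\<lambda>i. p k * c i - c k * p i)"
    by (rule sum.cong) auto
  also have "\<dots> = p k * ?S c - c k * ?S p"
    by (simp add: sum_subtractf sum_distrib_left algebra_simps)
  finally have "lin_comb (\<lambda>i. if i = k then c k * s else p k * c i - c k * p i) (ws[k := w]) j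
      = c k * (s * w $ j) + (p k * ?S c - c k * ?S p)"
    unfolding L by (simp add: algebra_simps)
  also have "\<dots> = p k * (c k * ws ! k $ j + ?S c)" unfolding w' by (simp add: algebra_simps)
  finally show "p k * lin_comb c ws j =
      lin_comb (\<lambda>i. if i = k then c k * s else p k * c i - c k * p i) (ws[k := w]) j"
    by (simp add: split)
qed

text \<open>Steinitz exchange over a domain: the factors \<open>s\<close> and \<open>p k\<close>
  need not be units, since \<open>saturation\<close> absorbs nonzero multipliers, and
  \<open>p k \<noteq> 0\<close> makes the replacement reversible.\<close>

lemma exchange:
  fixes ws :: "'a::idom vec list"
  assumes ind: "lin_indep q ws" and w: "w \<in> carrier_vec q" and k: "k < length ws"
    and s: "s \<noteq> 0" and p: "p k \<noteq> 0" and eq: "\<And>j. j < q \<Longrightarrow> s * w $ j = lin_comb p ws j"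
  shows "lin_indep q (ws[k := w])" and "saturation q (ws[k := w]) = saturation q ws"
proof -
  note upd = lin_comb_update[OF eq k]
  show "lin_indep q (ws[k := w])"
    unfolding lin_indep_def
  proof (intro allI impI)
    fix c i assume c: "\<forall>j<q. lin_comb c (ws[k := w]) j = 0" and i: "i < length (ws[k := w])"
    have 0: "(if l = k then 0 else s * c l) + c k * p l = 0" if l: "l < length ws" for l
      using lin_indepD[OF ind, of "\<lambda>l. (if l = k then 0 else s * c l) + c k * p l" l] upd(1)[of _ c] c l
      by simp
    have "c k = 0" using 0[OF k] p by simp
    then show "c i = 0" using 0[of i] i s by (auto split: if_splits)
  qed
  show "saturation q (ws[k := w]) = saturation q ws"
  proof (intro equalityI subsetI)
    fix v assume "v \<in> saturation q (ws[k := w])"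
    then obtain s1 c where v: "v \<in> carrier_vec q" "s1 \<noteq> 0"
      and c: "\<And>j. j < q \<Longrightarrow> s1 * v $ j = lin_comb c (ws[k := w]) j"
      unfolding saturation_def by blast
    have "s * s1 * v $ j = lin_comb (\<lambda>i. (if i = k then 0 else s * c i) + c k * p i) ws j" if "j < q" for j
      unfolding mult.assoc c[OF that] by (rule upd(1)[OF that])
    moreover have "s * s1 \<noteq> 0" using s v(2) by simp
    ultimately show "v \<in> saturation q ws" using v(1) unfolding saturation_def by blast
  next
    fix v assume "v \<in> saturation q ws"
    then obtain s1 c where v: "v \<in> carrier_vec q" "s1 \<noteq> 0"
      and c: "\<And>j. j < q \<Longrightarrow> s1 * v $ j = lin_comb c ws j"
      unfolding saturation_def by blast
    have "p k * s1 * v $ j = lin_comb (\<lambda>i. if i = k then c k * s else p k * c i - c k * p i) (ws[k := w]) j"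
      if "j < q" for j
      unfolding mult.assoc c[OF that] by (rule upd(2)[OF that])
    moreover have "p k * s1 \<noteq> 0" using p v(2) by simp
    ultimately show "v \<in> saturation q (ws[k := w])" using v(1) unfolding saturation_def by blast
  qed
qed

lemma degree_le_poly_vec_degree:
  assumes "v \<in> carrier_vec q" "j < q"
  shows "degree (v $ j) \<le> poly_vec_degree v"
  unfolding poly_vec_degree_def using assms by (intro Max_ge) auto

lemma poly_vec_degree_le:
  assumes "v \<in> carrier_vec q" "0 < q" "\<And>j. j < q \<Longrightarrow> degree (v $ j) \<le> D"
  shows "poly_vec_degree v \<le> D"
  unfolding poly_vec_degree_def using assms by (subst Max_le_iff) auto

text \<open>Competitors are the bases with the same saturation, so that no rational subspace is
  mentioned; \<open>is_minimal_basis_of_iff\<close> links this to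
  \<open>is_minimal_basis_of\<close>.\<close>

definition minimal_poly_basis :: "nat \<Rightarrow> 'a::field poly vec list \<Rightarrow> bool" where
  "minimal_poly_basis q bs \<longleftrightarrow> set bs \<subseteq> carrier_vec q \<and> lin_indep q bs \<and>
    (\<forall>cs. set cs \<subseteq> carrier_vec q \<and> lin_indep q cs \<and> saturation q cs = saturation q bs \<longrightarrow>
      sum_list (map poly_vec_degree bs) \<le> sum_list (map poly_vec_degree cs))"

text \<open>Otherwise exchanging \<open>bs ! k\<close> for \<open>w\<close> would lower the sum of
  degrees. The entry found is required to be nonzero because the zero polynomial has degree 0, so
  the degree bound alone would be void for a constant basis vector.\<close>

lemma minimal_exchange:
  assumes min: "minimal_poly_basis q bs" and k: "k < length bs"
    and s: "s \<noteq> 0" and p: "p k \<noteq> 0" and eq: "\<And>j. j < q \<Longrightarrow> s * w j = lin_comb p bs j"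
  shows "\<exists>j<q. w j \<noteq> 0 \<and> poly_vec_degree (bs ! k) \<le> degree (w j)"
proof (rule ccontr)
  assume neg: "\<not> ?thesis"
  have c: "set bs \<subseteq> carrier_vec q" and ind: "lin_indep q bs"
    using min unfolding minimal_poly_basis_def by blast+
  have "\<exists>j<q. w j \<noteq> 0"
  proof (rule ccontr)
    assume "\<not> ?thesis"
    then have "lin_comb p bs j = 0" if "j < q" for j using eq[OF that] that by auto
    then show False using lin_indepD[OF ind, of p k] k p by blast
  qed
  \<comment> \<open>A nonzero entry has degree below that of \<open>bs ! k\<close>, so the latter is
    positive and subtracting 1 from it does not truncate.\<close>
  then have q: "0 < q" and pos: "0 < poly_vec_degree (bs ! k)" using neg by auto
  define u where "u = vec q w"
  have u: "u \<in> carrier_vec q" by (simp add: u_def)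
  have "degree (u $ j) \<le> poly_vec_degree (bs ! k) - 1" if "j < q" for j
  proof (cases "w j = 0")
    case False
    then have "degree (w j) < poly_vec_degree (bs ! k)" using neg that by force
    then show ?thesis using that by (simp add: u_def)
  qed (simp add: u_def that)
  then have du: "poly_vec_degree u < poly_vec_degree (bs ! k)"
    using poly_vec_degree_le[OF u q, of "poly_vec_degree (bs ! k) - 1"] pos by fastforce
  have eq': "s * u $ j = lin_comb p bs j" if "j < q" for j using eq[OF that] that by (simp add: u_def)
  have "set (bs[k := u]) \<subseteq> carrier_vec q" using c u set_update_subset_insert[of bs k u] by blast
  then have "sum_list (map poly_vec_degree bs) \<le> sum_list (map poly_vec_degree (bs[k := u]))"
    using min exchange[OF ind u k s p eq'] unfolding minimal_poly_basis_def by blast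
  also have "\<dots> = sum_list (map poly_vec_degree bs) + poly_vec_degree u - poly_vec_degree (bs ! k)"
    using k by (simp add: map_update sum_list_update)
  finally show False
    using du member_le_sum_list[of "poly_vec_degree (bs ! k)" "map poly_vec_degree bs"] k by simp
qed

text \<open>Only upper bounds are assumed: a top coefficient may vanish, as it does for single
  entries of a row or of a basis vector.\<close>

lemma coeff_mult_degree_bounds:
  fixes p b :: "'a::comm_semiring_1 poly"
  assumes "degree p \<le> m" "degree b \<le> e"
  shows "coeff (p * b) (m + e) = coeff p m * coeff b e"
proof -
  have "coeff (p * b) (m + e) = (\<Sum>i\<le>m + e. coeff p i * coeff b (m + e - i))" by (rule coeff_mult)
  also have "\<dots> = (\<Sum>i\<in>{m}. coeff p i * coeff b (m + e - i))"
  proof (rule sum.mono_neutral_right)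
    show "\<forall>i\<in>{..m + e} - {m}. coeff p i * coeff b (m + e - i) = 0"
    proof
      fix i assume i: "i \<in> {..m + e} - {m}"
      then consider "m < i" | "e < m + e - i" by fastforce
      then show "coeff p i * coeff b (m + e - i) = 0"
        using assms by cases (simp_all add: coeff_eq_0)
    qed
  qed auto
  finally show ?thesis by simp
qed

text \<open>A violation of the degree bounds produces, by cancellation, a vector of the module that
  is shorter than some basis vector involved in it.\<close>

theorem predictable_degree:
  assumes min: "minimal_poly_basis q bs" and q: "0 < q" and v: "v \<in> saturation q bs"
  shows "\<exists>p. (\<forall>j<q. v $ j = lin_comb p bs j) \<and>
    (\<forall>i<length bs. p i \<noteq> 0 \<longrightarrow> degree (p i) + poly_vec_degree (bs ! i) \<le> poly_vec_degree v)"
proof -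
  have c: "set bs \<subseteq> carrier_vec q" and ind: "lin_indep q bs"
    using min unfolding minimal_poly_basis_def by blast+
  have bc: "bs ! i \<in> carrier_vec q" if "i < length bs" for i using c that by auto
  define \<epsilon> where "\<epsilon> i = poly_vec_degree (bs ! i)" for i
  have deg_b: "degree (bs ! i $ j) \<le> \<epsilon> i" if "i < length bs" "j < q" for i j
    unfolding \<epsilon>_def by (rule degree_le_poly_vec_degree[OF bc[OF that(1)] that(2)])
  obtain s a where vc: "v \<in> carrier_vec q" and s: "s \<noteq> 0"
    and a: "\<And>j. j < q \<Longrightarrow> s * v $ j = lin_comb a bs j"
    using v unfolding saturation_def by blast
  \<comment> \<open>First half: \<open>s\<close> divides every \<open>a i\<close>. If not,
    subtracting the quotient part from \<open>v\<close> leaves a polynomial vector \<open>w\<close>,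
    and \<open>s * w\<close> is the combination with the remainders. For \<open>k\<close> of largest
    degree among the vectors with nonzero remainder, exchange gives an entry of \<open>s * w\<close>
    of degree at least \<open>degree s + \<epsilon> k\<close>, but remainders have degree below that
    of \<open>s\<close>.\<close>
  have r0: "a i mod s = 0" if i: "i < length bs" for i
  proof (rule ccontr)
    assume ne: "a i mod s \<noteq> 0"
    define K where "K = {i. i < length bs \<and> a i mod s \<noteq> 0}"
    have finK: "finite K" and "K \<noteq> {}" using i ne by (auto simp: K_def)
    then obtain k where kK: "k \<in> K" and kmax: "\<And>i. i \<in> K \<Longrightarrow> \<epsilon> i \<le> \<epsilon> k"
      using obtains_MAX[of K \<epsilon>] by (metis Max_ge finite_imageI imageI)
    have k: "k < length bs" and kne: "a k mod s \<noteq> 0" using kK by (auto simp: K_def)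
    define w where "w j = v $ j - lin_comb (\<lambda>i. a i div s) bs j" for j
    have w: "s * w j = lin_comb (\<lambda>i. a i mod s) bs j" if "j < q" for j
    proof -
      have "lin_comb a bs j = s * lin_comb (\<lambda>i. a i div s) bs j + lin_comb (\<lambda>i. a i mod s) bs j"
        unfolding lin_comb_def sum_distrib_left sum.distrib[symmetric]
        by (rule sum.cong) (simp_all add: mult.assoc[symmetric] distrib_right[symmetric])
      then show ?thesis using a[OF that] by (simp add: w_def right_diff_distrib)
    qed
    obtain j where j: "j < q" "w j \<noteq> 0" "\<epsilon> k \<le> degree (w j)"
      using minimal_exchange[OF min k s, where p = "\<lambda>i. a i mod s" and w = w, OF kne w] unfolding \<epsilon>_def by auto
    have degs: "degree (a i mod s) < degree s" if "i \<in> K" for i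
      using that degree_mod_less[OF s, of "a i"] by (auto simp: K_def)
    have "degree (lin_comb (\<lambda>i. a i mod s) bs j) < degree s + \<epsilon> k"
      unfolding lin_comb_def
    proof (rule degree_sum_less)
      show "0 < degree s + \<epsilon> k" using degs[OF kK] by simp
      fix l assume l: "l \<in> {..<length bs}"
      show "degree (a l mod s * bs ! l $ j) < degree s + \<epsilon> k"
      proof (cases "l \<in> K")
        case True
        then show ?thesis
          using degree_mult_le[of "a l mod s" "bs ! l $ j"] degs kmax deg_b[of l j] l j by fastforce
      next
        case False
        then show ?thesis using l degs[OF kK] by (auto simp: K_def)
      qed
    qed
    moreover have "degree (s * w j) = degree s + degree (w j)" using s j by (simp add: degree_mult_eq)
    ultimately show False using w[OF j(1)] j(3) by simp
  qed
  define p where "p i = a i div s" for i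
  have vp: "v $ j = lin_comb p bs j" if "j < q" for j
  proof -
    have "lin_comb a bs j = s * lin_comb p bs j"
      unfolding lin_comb_def sum_distrib_left p_def
      by (rule sum.cong) (use r0 in \<open>auto simp: mult.assoc[symmetric] mod_eq_0_iff_dvd\<close>)
    then show ?thesis using a[OF that] s by simp
  qed
  \<comment> \<open>Second half: if a product exceeds the degree of \<open>v\<close>, the terms of
    the largest degree \<open>D\<close> cancel. \<open>K\<close> collects the products reaching
    \<open>D\<close>, and \<open>k\<close> is a member whose basis vector has largest
    degree.\<close>
  have "degree (p i) + \<epsilon> i \<le> poly_vec_degree v" if i: "i < length bs" "p i \<noteq> 0" for i
  proof (rule ccontr)
    assume big: "\<not> ?thesis"
    define J where "J = {i. i < length bs \<and> p i \<noteq> 0}"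
    have "finite J" "J \<noteq> {}" using i by (auto simp: J_def)
    then obtain l where lJ: "l \<in> J" and lmax: "\<And>i. i \<in> J \<Longrightarrow> degree (p i) + \<epsilon> i \<le> degree (p l) + \<epsilon> l"
      using obtains_MAX[of J "\<lambda>i. degree (p i) + \<epsilon> i"] by (metis (no_types, lifting) Max_ge finite_imageI imageI)
    define D where "D = degree (p l) + \<epsilon> l"
    define K where "K = {i \<in> J. degree (p i) + \<epsilon> i = D}"
    have D: "poly_vec_degree v < D" using lmax[of i] big i by (simp add: J_def D_def)
    have "finite K" "K \<noteq> {}" using \<open>finite J\<close> lJ by (auto simp: K_def D_def)
    then obtain k where kK: "k \<in> K" and kmax: "\<And>i. i \<in> K \<Longrightarrow> \<epsilon> i \<le> \<epsilon> k"
      using obtains_MAX[of K \<epsilon>] by (metis Max_ge finite_imageI imageI)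
    \<comment> \<open>The leading terms of the \<open>p i\<close> with \<open>i\<close> in
      \<open>K\<close>, all divided by the same power, with exponent
      \<open>D - \<epsilon> k\<close>. The choice of \<open>k\<close> makes
      \<open>\<epsilon> k - \<epsilon> i\<close> a genuine difference.\<close>
    define c where "c i = (if i \<in> K then monom (lead_coeff (p i)) (\<epsilon> k - \<epsilon> i) else 0)" for i
    have k: "k < length bs" "p k \<noteq> 0" using kK by (auto simp: K_def J_def)
    have "c k \<noteq> 0" using kK k by (simp add: c_def)
    then obtain j where j: "j < q" "lin_comb c bs j \<noteq> 0" "\<epsilon> k \<le> degree (lin_comb c bs j)"
      using minimal_exchange[OF min k(1), of 1 c "lin_comb c bs"] unfolding \<epsilon>_def by auto
    have coeff_c: "degree (c i * bs ! i $ j) \<le> \<epsilon> k \<and>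
        coeff (c i * bs ! i $ j) (\<epsilon> k) = coeff (p i * bs ! i $ j) D"
      if il: "i < length bs" for i
    proof (cases "i \<in> K")
      case True
      have le: "\<epsilon> i \<le> \<epsilon> k" by (rule kmax[OF True])
      have dc: "degree (c i) \<le> \<epsilon> k - \<epsilon> i" using True by (simp add: c_def degree_monom_le)
      have Di: "D = degree (p i) + \<epsilon> i" using True by (simp add: K_def)
      have "degree (c i * bs ! i $ j) \<le> (\<epsilon> k - \<epsilon> i) + \<epsilon> i"
        using degree_mult_le[of "c i" "bs ! i $ j"] dc deg_b[OF il j(1)] by linarith
      moreover have "coeff (c i * bs ! i $ j) ((\<epsilon> k - \<epsilon> i) + \<epsilon> i) = lead_coeff (p i) * coeff (bs ! i $ j) (\<epsilon> i)"
        using coeff_mult_degree_bounds[OF dc deg_b[OF il j(1)]] True by (simp add: c_def)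
      moreover have "coeff (p i * bs ! i $ j) D = lead_coeff (p i) * coeff (bs ! i $ j) (\<epsilon> i)"
        unfolding Di by (rule coeff_mult_degree_bounds[OF order_refl deg_b[OF il j(1)]])
      ultimately show ?thesis using le by simp
    next
      case False
      have "coeff (p i * bs ! i $ j) D = 0"
      proof (cases "p i = 0")
        case pi: False
        then have "i \<in> J" using il by (simp add: J_def)
        then have "degree (p i) + \<epsilon> i < D" using lmax[of i] False by (force simp: K_def D_def)
        then have "degree (p i * bs ! i $ j) < D"
          using degree_mult_le[of "p i" "bs ! i $ j"] deg_b[OF il j(1)] by linarith
        then show ?thesis by (rule coeff_eq_0)
      qed simp
      then show ?thesis using False by (simp add: c_def)
    qed
    \<comment> \<open>Coefficient \<open>\<epsilon> k\<close> of the new combination is coefficient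
      \<open>D\<close> of \<open>v\<close>, which vanishes; so the combination is shorter than
      \<open>bs ! k\<close>, against minimality.\<close>
    have "coeff (lin_comb c bs j) (\<epsilon> k) = coeff (lin_comb p bs j) D"
      unfolding lin_comb_def coeff_sum by (rule sum.cong) (simp_all add: coeff_c)
    also have "\<dots> = 0"
      unfolding vp[OF j(1), symmetric]
      using degree_le_poly_vec_degree[OF vc j(1)] D by (intro coeff_eq_0) linarith
    finally have z: "coeff (lin_comb c bs j) (\<epsilon> k) = 0" .
    have "degree (lin_comb c bs j) \<le> \<epsilon> k"
      unfolding lin_comb_def using coeff_c by (intro degree_sum_le) auto
    then have "degree (lin_comb c bs j) = \<epsilon> k" using j(3) by simp
    then show False using z j(2) by (metis leading_coeff_0_iff)
  qed
  then show ?thesis using vp unfolding \<epsilon>_def by blast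
qed

section \<open>Trimmed Sylvester matrices\<close>

lemma sum_lessThan_mult:
  "(\<Sum>s<k * q. g s) = (\<Sum>a<k. \<Sum>j<q. g (a * q + j))" for g :: "nat \<Rightarrow> 'a::comm_monoid_add"
proof (induction k)
  case (Suc k)
  have "(\<Sum>s<Suc k * q. g s) = (\<Sum>s<k * q. g s) + (\<Sum>s\<in>{k * q..<k * q + q}. g s)"
    using sum.atLeastLessThan_concat[of 0 "k * q" "k * q + q" g]
    by (simp add: lessThan_atLeast0 add.commute)
  also have "(\<Sum>s\<in>{k * q..<k * q + q}. g s) = (\<Sum>j<q. g (k * q + j))"
    using sum.shift_bounds_nat_ivl[of g 0 "k * q" q] by (simp add: lessThan_atLeast0 add.commute)
  finally show ?case using Suc by simp
qed simp

text \<open>Block \<open>a\<close> of a vector with \<open>k\<close> blocks of length \<open>q\<close> holds the coefficients of degree \<open>a\<close>.\<close>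

definition poly_of_blocks :: "nat \<Rightarrow> nat \<Rightarrow> 'a::comm_monoid_add vec \<Rightarrow> nat \<Rightarrow> 'a poly" where
  "poly_of_blocks k q x j = (\<Sum>a<k. monom (x $ (a * q + j)) a)"

definition blocks_of_poly :: "nat \<Rightarrow> nat \<Rightarrow> 'a::zero poly vec \<Rightarrow> 'a vec" where
  "blocks_of_poly k q v = vec (k * q) (\<lambda>s. coeff (v $ (s mod q)) (s div q))"

lemma coeff_poly_of_blocks: "coeff (poly_of_blocks k q x j) a = (if a < k then x $ (a * q + j) else 0)"
  by (simp add: poly_of_blocks_def coeff_sum)

lemma degree_poly_of_blocks: "0 < k \<Longrightarrow> degree (poly_of_blocks k q x j) \<le> k - 1"
  by (intro degree_le) (auto simp: coeff_poly_of_blocks)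

lemma block_index_less: "a < k \<Longrightarrow> j < q \<Longrightarrow> a * q + j < k * q" for a k j q :: nat
proof -
  assume a: "a < k" and j: "j < q"
  then have "a * q + j < Suc a * q" by simp
  also have "\<dots> \<le> k * q" using a by (intro mult_le_mono1) simp
  finally show ?thesis .
qed

lemma poly_of_blocks_of_poly:
  assumes "degree (v $ j) < k" "j < q"
  shows "poly_of_blocks k q (blocks_of_poly k q v) j = v $ j"
proof (rule poly_eqI)
  fix a
  show "coeff (poly_of_blocks k q (blocks_of_poly k q v) j) a = coeff (v $ j) a"
    using assms block_index_less[of a k j q]
    by (auto simp: coeff_poly_of_blocks blocks_of_poly_def coeff_eq_0)
qed

text \<open>An entry of the product of \<open>M\<close> with a column. The column is a function, so
  that vectors and the output of \<open>poly_of_blocks\<close> are treated alike.\<close>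

definition row_action :: "'a::comm_semiring_0 mat \<Rightarrow> (nat \<Rightarrow> 'a) \<Rightarrow> nat \<Rightarrow> 'a" where
  "row_action M w i = (\<Sum>j<dim_col M. M $$ (i, j) * w j)"

lemma coeff_mult_monom: "coeff (p * monom c a) n = (if a \<le> n then coeff p (n - a) * c else 0)"
  for p :: "'a::comm_semiring_1 poly"
  using coeff_monom_mult[of c a p n] by (auto simp: mult.commute)

context
  fixes d :: "nat list" and m q k :: nat and M :: "'a::field poly mat"
  assumes M: "M \<in> poly_mat_space d m q" and d: "length d = m" and k: "0 < k"
begin

private lemma Mc: "M \<in> carrier_mat m q" and deg_M: "i < m \<Longrightarrow> j < q \<Longrightarrow> degree (M $$ (i, j)) \<le> d ! i"
  using M by (auto simp: poly_mat_space_def)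

text \<open>The bound equals the number of rows of index \<open>i\<close> that trimming keeps, so
  the kept rows see every coefficient of the product.\<close>

lemma degree_row_action:
  assumes "i < m"
  shows "degree (row_action M (poly_of_blocks k q x) i) < k + d ! i"
  unfolding row_action_def
proof (rule degree_sum_less)
  show "0 < k + d ! i" using k by simp
  fix j assume "j \<in> {..<dim_col M}"
  then have "j < q" using Mc by simp
  then show "degree (M $$ (i, j) * poly_of_blocks k q x j) < k + d ! i"
    using degree_mult_le[of "M $$ (i, j)" "poly_of_blocks k q x j"] deg_M[OF assms]
      degree_poly_of_blocks[OF k, of q x j] k by fastforce
qed

text \<open>Block p of the product is the convolution of the M_(p-a) with the blocks x_a, hence
  coefficient p of a polynomial product.\<close>

lemma sylvester_mult:
  assumes x: "x \<in> carrier_vec (k * q)" and r: "r < (k + Max (set d)) * m"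
  shows "(sylvester_mat d k M *\<^sub>v x) $ r = coeff (row_action M (poly_of_blocks k q x) (r mod m)) (r div m)"
proof -
  let ?e = "Max (set d)" and ?i = "r mod m" and ?p = "r div m"
  have m: "0 < m" using r by (cases m) auto
  then have i: "?i < m" by simp
  have de: "d ! ?i \<le> ?e" using i d by (intro Max_ge) auto
  have dims: "dim_row M = m" "dim_col M = q" using Mc by auto
  have dimS: "dim_row (sylvester_mat d k M) = (k + ?e) * m" "dim_col (sylvester_mat d k M) = k * q"
    by (simp_all add: sylvester_mat_def Let_def dims)
  have entry: "sylvester_mat d k M $$ (r, a * q + j) = (if a \<le> ?p then coeff (M $$ (?i, j)) (?p - a) else 0)"
    if "a < k" "j < q" for a j
  proof -
    \<comment> \<open>The cutoff at \<open>?e\<close> in the definition only replaces coefficients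
      that are zero anyway.\<close>
    have "coeff (M $$ (?i, j)) (?p - a) = 0" if "\<not> ?p - a \<le> ?e"
      using that deg_M[OF i \<open>j < q\<close>] de by (intro coeff_eq_0) linarith
    then show ?thesis
      using that r block_index_less[OF that] i
      by (simp add: sylvester_mat_def Let_def dims coeff_mat_def)
  qed
  have "(sylvester_mat d k M *\<^sub>v x) $ r = (\<Sum>s<k * q. sylvester_mat d k M $$ (r, s) * x $ s)"
    using r x dimS by (simp add: scalar_prod_def lessThan_atLeast0)
  also have "\<dots> = (\<Sum>a<k. \<Sum>j<q. sylvester_mat d k M $$ (r, a * q + j) * x $ (a * q + j))"
    by (rule sum_lessThan_mult)
  also have "\<dots> = (\<Sum>a<k. \<Sum>j<q. coeff (M $$ (?i, j) * monom (x $ (a * q + j)) a) ?p)"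
    by (intro sum.cong refl) (simp add: entry coeff_mult_monom)
  also have "\<dots> = (\<Sum>j<q. \<Sum>a<k. coeff (M $$ (?i, j) * monom (x $ (a * q + j)) a) ?p)"
    by (rule sum.swap)
  also have "\<dots> = coeff (row_action M (poly_of_blocks k q x) ?i) ?p"
    by (simp add: row_action_def poly_of_blocks_def dims sum_distrib_left coeff_sum)
  finally show ?thesis .
qed

text \<open>The bijection \<open>f\<close> labels each kept row by its row index in \<open>M\<close>
  and its power of \<lambda>. Kernel and surjectivity are invariant under permuting rows, so this
  labelling determines both.\<close>

lemma trimmed_sylvester_mult:
  shows "trimmed_sylvester_mat d k M \<in> carrier_mat (k * m + sum_list d) (k * q)"
    and "\<exists>f. bij_betw f {..<k * m + sum_list d} (SIGMA i:{..<m}. {..<k + d ! i}) \<and>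
      (\<forall>x\<in>carrier_vec (k * q). \<forall>t<k * m + sum_list d. (trimmed_sylvester_mat d k M *\<^sub>v x) $ t =
        coeff (row_action M (poly_of_blocks k q x) (fst (f t))) (snd (f t)))"
proof -
  let ?e = "Max (set d)"
  \<comment> \<open>As \<open>d ! i \<le> ?e\<close>, the double difference is
    \<open>k + d ! i\<close>. The set \<open>J\<close> below consists of the row numbers that
    \<open>submatrix\<close> counts.\<close>
  define I where "I = - {r. r div m \<ge> (k + ?e) - (?e - d ! (r mod m))}"
  define J where "J = {r. r < (k + ?e) * m \<and> r \<in> I}"
  define g where "g r = (r mod m, r div m)" for r
  have de: "d ! i \<le> ?e" if "i < m" for i using that d by (intro Max_ge) auto
  have dims: "dim_row M = m" "dim_col M = q" using Mc by auto
  have T: "trimmed_sylvester_mat d k M = submatrix (sylvester_mat d k M) I UNIV"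
    by (simp add: trimmed_sylvester_mat_def Let_def dims I_def)
  have dimS: "dim_row (sylvester_mat d k M) = (k + ?e) * m" "dim_col (sylvester_mat d k M) = k * q"
    by (simp_all add: sylvester_mat_def Let_def dims)
  have bij_g: "bij_betw g J (SIGMA i:{..<m}. {..<k + d ! i})"
  proof (rule bij_betw_byWitness[where f' = "\<lambda>(i, p). p * m + i"])
    show "\<forall>r\<in>J. (case g r of (i, p) \<Rightarrow> p * m + i) = r" by (simp add: g_def)
    show "\<forall>z\<in>SIGMA i:{..<m}. {..<k + d ! i}. g (case z of (i, p) \<Rightarrow> p * m + i) = z"
      by (auto simp: g_def)
    show "g ` J \<subseteq> (SIGMA i:{..<m}. {..<k + d ! i})"
    proof
      fix z assume "z \<in> g ` J"
      then obtain r where r: "r < (k + ?e) * m" "r \<in> I" and z: "z = g r" by (auto simp: J_def)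
      then have "r mod m < m" by (cases m) auto
      then show "z \<in> (SIGMA i:{..<m}. {..<k + d ! i})"
        using r(2) de[of "r mod m"] by (auto simp: z g_def I_def)
    qed
    show "(\<lambda>(i, p). p * m + i) ` (SIGMA i:{..<m}. {..<k + d ! i}) \<subseteq> J"
    proof
      fix r assume "r \<in> (\<lambda>(i, p). p * m + i) ` (SIGMA i:{..<m}. {..<k + d ! i})"
      then obtain i p where ip: "i < m" "p < k + d ! i" and r: "r = p * m + i" by auto
      have "p < k + ?e" using ip de[of i] by linarith
      then have "r < (k + ?e) * m" unfolding r using ip(1) by (rule block_index_less)
      then show "r \<in> J" using ip de[of i] by (auto simp: J_def I_def r)
    qed
  qed
  have finJ: "finite J" by (simp add: J_def)
  have "card J = card (SIGMA i:{..<m}. {..<k + d ! i})" by (rule bij_betw_same_card[OF bij_g])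
  also have "\<dots> = (\<Sum>i<m. k + d ! i)" by simp
  also have "\<dots> = k * m + sum_list d"
    using d by (simp add: sum.distrib sum_list_sum_nth lessThan_atLeast0)
  finally have cardJ: "card J = k * m + sum_list d" .
  have bij_pick: "bij_betw (pick I) {..<k * m + sum_list d} J"
  proof -
    \<comment> \<open>\<open>submatrix\<close> enumerates by \<open>pick I\<close>; below
      \<open>card J\<close> this is the increasing enumeration of the finite set
      \<open>J\<close>.\<close>
    have pJ: "pick I t = pick J t" if "t < card J" for t
      using pick_reduce_set[of t "(k + ?e) * m" I] that unfolding J_def by simp
    have inj: "inj_on (pick J) {..<card J}"
    proof (rule linorder_inj_onI)
      fix s t assume "s < t" "s \<in> {..<card J}" "t \<in> {..<card J}"
      then show "pick J s \<noteq> pick J t" using pick_mono_le[of t J s] by simp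
    qed auto
    have sub: "pick J ` {..<card J} \<subseteq> J" using pick_in_set_le[of _ J] by auto
    have "pick J ` {..<card J} = J"
      using card_image[OF inj] sub finJ by (intro card_subset_eq) simp_all
    then have "bij_betw (pick J) {..<card J} J" using inj by (simp add: bij_betw_def)
    then show ?thesis
      unfolding cardJ[symmetric] by (rule bij_betw_cong[THEN iffD1, rotated]) (simp add: pJ)
  qed
  have rows: "card {r. r < (k + ?e) * m \<and> r \<in> I} = k * m + sum_list d"
    using cardJ unfolding J_def .
  show Tc: "trimmed_sylvester_mat d k M \<in> carrier_mat (k * m + sum_list d) (k * q)"
    unfolding T by (intro carrier_matI) (simp_all add: dim_submatrix rows dimS)
  have "(trimmed_sylvester_mat d k M *\<^sub>v x) $ t =
      coeff (row_action M (poly_of_blocks k q x) (fst (g (pick I t)))) (snd (g (pick I t)))"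
    if x: "x \<in> carrier_vec (k * q)" and t: "t < k * m + sum_list d" for x t
  proof -
    have "pick I t \<in> J" using bij_pick t by (auto simp: bij_betw_def)
    then have r: "pick I t < (k + ?e) * m" by (simp add: J_def)
    have "(trimmed_sylvester_mat d k M *\<^sub>v x) $ t = (\<Sum>s<k * q. trimmed_sylvester_mat d k M $$ (t, s) * x $ s)"
      using Tc x t by (simp add: scalar_prod_def lessThan_atLeast0)
    also have "\<dots> = (\<Sum>s<k * q. sylvester_mat d k M $$ (pick I t, s) * x $ s)"
      using t by (intro sum.cong refl) (simp add: T submatrix_def rows dimS pick_UNIV)
    also have "\<dots> = (sylvester_mat d k M *\<^sub>v x) $ pick I t"
      using r x dimS by (simp add: scalar_prod_def lessThan_atLeast0)
    finally show ?thesis using sylvester_mult[OF x r] by (simp add: g_def)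
  qed
  moreover have "bij_betw (g \<circ> pick I) {..<k * m + sum_list d} (SIGMA i:{..<m}. {..<k + d ! i})"
    using bij_pick bij_g by (rule bij_betw_trans)
  ultimately show "\<exists>f. bij_betw f {..<k * m + sum_list d} (SIGMA i:{..<m}. {..<k + d ! i}) \<and>
      (\<forall>x\<in>carrier_vec (k * q). \<forall>t<k * m + sum_list d. (trimmed_sylvester_mat d k M *\<^sub>v x) $ t =
        coeff (row_action M (poly_of_blocks k q x) (fst (f t))) (snd (f t)))"
    by (intro exI[of _ "g \<circ> pick I"]) simp
qed

lemma trimmed_sylvester_kernel:
  "x \<in> mat_kernel (trimmed_sylvester_mat d k M) \<longleftrightarrow>
    x \<in> carrier_vec (k * q) \<and> (\<forall>i<m. row_action M (poly_of_blocks k q x) i = 0)"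
proof -
  let ?T = "trimmed_sylvester_mat d k M" and ?N = "k * m + sum_list d"
  note Tc = trimmed_sylvester_mult(1)
  obtain f where bij: "bij_betw f {..<?N} (SIGMA i:{..<m}. {..<k + d ! i})"
    and f: "\<And>x t. x \<in> carrier_vec (k * q) \<Longrightarrow> t < ?N \<Longrightarrow>
      (?T *\<^sub>v x) $ t = coeff (row_action M (poly_of_blocks k q x) (fst (f t))) (snd (f t))"
    using trimmed_sylvester_mult(2) by blast
  have "?T *\<^sub>v x = 0\<^sub>v ?N \<longleftrightarrow> (\<forall>i<m. row_action M (poly_of_blocks k q x) i = 0)"
    if x: "x \<in> carrier_vec (k * q)"
  proof -
    let ?F = "row_action M (poly_of_blocks k q x)"
    have "?T *\<^sub>v x = 0\<^sub>v ?N \<longleftrightarrow> (\<forall>t\<in>{..<?N}. coeff (?F (fst (f t))) (snd (f t)) = 0)"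
      using Tc f[OF x] by (auto simp: vec_eq_iff)
    also have "\<dots> \<longleftrightarrow> (\<forall>z\<in>f ` {..<?N}. coeff (?F (fst z)) (snd z) = 0)" by blast
    also have "f ` {..<?N} = (SIGMA i:{..<m}. {..<k + d ! i})" using bij by (simp add: bij_betw_def)
    also have "(\<forall>z\<in>(SIGMA i:{..<m}. {..<k + d ! i}). coeff (?F (fst z)) (snd z) = 0) \<longleftrightarrow>
        (\<forall>i<m. \<forall>p<k + d ! i. coeff (?F i) p = 0)"
      by auto
    also have "\<dots> \<longleftrightarrow> (\<forall>i<m. ?F i = 0)"
    proof (intro iffI allI impI)
      fix i assume c: "\<forall>i<m. \<forall>p<k + d ! i. coeff (?F i) p = 0" and i: "i < m"
      have "lead_coeff (?F i) = 0" using c i degree_row_action[OF i] by blast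
      then show "?F i = 0" by simp
    qed simp
    finally show ?thesis .
  qed
  then show ?thesis using Tc by (auto simp: mat_kernel_def)
qed

text \<open>At power \<open>d ! i + (k - 1)\<close> only the top coefficients of row
  \<open>i\<close> and the last block of \<open>x\<close> meet, so the last block of a suitable
  preimage solves the system with the leading coefficient matrix.\<close>

lemma leading_coeff_surj:
  assumes surj: "\<forall>y\<in>carrier_vec (k * m + sum_list d). \<exists>x\<in>carrier_vec (k * q). trimmed_sylvester_mat d k M *\<^sub>v x = y"
    and y: "y \<in> carrier_vec m"
  shows "\<exists>z\<in>carrier_vec q. leading_row_coeff_mat d M *\<^sub>v z = y"
proof -
  let ?T = "trimmed_sylvester_mat d k M" and ?N = "k * m + sum_list d"
  obtain f where bij: "bij_betw f {..<?N} (SIGMA i:{..<m}. {..<k + d ! i})"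
    and f: "\<And>x t. x \<in> carrier_vec (k * q) \<Longrightarrow> t < ?N \<Longrightarrow>
      (?T *\<^sub>v x) $ t = coeff (row_action M (poly_of_blocks k q x) (fst (f t))) (snd (f t))"
    using trimmed_sylvester_mult(2) by blast
  \<comment> \<open>The right-hand side repeats \<open>y $ i\<close> in all rows of index
    \<open>i\<close>; only the last one of each index is read off.\<close>
  obtain x where x: "x \<in> carrier_vec (k * q)" and Tx: "?T *\<^sub>v x = vec ?N (\<lambda>t. y $ fst (f t))"
    using surj by (meson vec_carrier)
  define z where "z = vec q (\<lambda>j. x $ ((k - 1) * q + j))"
  have dims: "dim_row M = m" "dim_col M = q" using Mc by auto
  have "(\<Sum>j<q. coeff (M $$ (i, j)) (d ! i) * z $ j) = y $ i" if i: "i < m" for i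
  proof -
    have "(i, d ! i + (k - 1)) \<in> f ` {..<?N}" using bij i k by (simp add: bij_betw_def)
    then obtain t where t: "t < ?N" "f t = (i, d ! i + (k - 1))" by auto
    have "(\<Sum>j<q. coeff (M $$ (i, j)) (d ! i) * z $ j)
        = (\<Sum>j<q. coeff (M $$ (i, j) * poly_of_blocks k q x j) (d ! i + (k - 1)))"
      using coeff_mult_degree_bounds[OF deg_M[OF i] degree_poly_of_blocks[OF k]] k
      by (intro sum.cong refl) (simp add: z_def coeff_poly_of_blocks)
    also have "\<dots> = coeff (row_action M (poly_of_blocks k q x) i) (d ! i + (k - 1))"
      by (simp add: row_action_def dims coeff_sum)
    also have "\<dots> = y $ i" using f[OF x t(1)] t unfolding Tx by simp
    finally show ?thesis .
  qed
  then have "leading_row_coeff_mat d M *\<^sub>v z = y"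
    using y by (intro eq_vecI) (simp_all add: leading_row_coeff_mat_def dims scalar_prod_def z_def lessThan_atLeast0)
  then show ?thesis by (auto simp: z_def)
qed

end

section \<open>Dimension of the kernel of a trimmed Sylvester matrix\<close>

lemma coeff_lin_comb_expand:
  assumes "\<And>i l. i < length bs \<Longrightarrow> N i \<le> l \<Longrightarrow> coeff (P i) l = 0"
  shows "coeff (lin_comb P bs j) a =
    (\<Sum>(i, l)\<in>(SIGMA i:{..<length bs}. {..<N i}). coeff (P i) l * coeff (monom 1 l * bs ! i $ j) a)"
proof -
  have "coeff (P i * bs ! i $ j) a = (\<Sum>l<N i. coeff (P i) l * coeff (monom 1 l * bs ! i $ j) a)"
    if i: "i < length bs" for i
  proof -
    have "P i = (\<Sum>l<N i. Polynomial.smult (coeff (P i) l) (monom 1 l))"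
    proof (rule poly_eqI)
      fix n
      have "coeff (\<Sum>l<N i. Polynomial.smult (coeff (P i) l) (monom 1 l)) n = (\<Sum>l<N i. if n = l then coeff (P i) l else 0)"
        by (simp add: coeff_sum smult_monom)
      then show "coeff (P i) n = coeff (\<Sum>l<N i. Polynomial.smult (coeff (P i) l) (monom 1 l)) n"
        using assms[OF i, of n] by auto
    qed
    then have "P i * bs ! i $ j = (\<Sum>l<N i. Polynomial.smult (coeff (P i) l) (monom 1 l)) * bs ! i $ j"
      by (rule arg_cong)
    also have "\<dots> = (\<Sum>l<N i. Polynomial.smult (coeff (P i) l) (monom 1 l * bs ! i $ j))"
      by (simp only: sum_distrib_right mult_smult_left)
    finally have "P i * bs ! i $ j = (\<Sum>l<N i. Polynomial.smult (coeff (P i) l) (monom 1 l * bs ! i $ j))" .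
    then show ?thesis by (simp only: coeff_sum coeff_smult)
  qed
  then show ?thesis
    by (simp add: lin_comb_def coeff_sum sum.Sigma)
qed

text \<open>The shifts \<lambda>^l b_i with l + deg b_i < k form a basis of the kernel: they are
  independent because the b_i are, and they span by the predictable degree property. Truncated
  subtraction gives no shifts to a b_i of degree at least k.\<close>

theorem rank_trimmed_sylvester:
  fixes M :: "'a::field poly mat"
  assumes M: "M \<in> poly_mat_space d m q" and d: "length d = m" and k: "0 < k" and q: "0 < q"
    and min: "minimal_poly_basis q bs"
    and sat: "saturation q bs = {v \<in> carrier_vec q. \<forall>i<m. row_action M (\<lambda>j. v $ j) i = 0}"
  shows "vec_space.rank (k * m + sum_list d) (trimmed_sylvester_mat d k M) +
    (\<Sum>i<length bs. k - poly_vec_degree (bs ! i)) = k * q"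
proof -
  let ?T = "trimmed_sylvester_mat d k M"
  interpret vec_space "TYPE('a)" "k * q" .
  have Tc: "?T \<in> carrier_mat (k * m + sum_list d) (k * q)"
    by (rule trimmed_sylvester_mult(1)[OF M d k])
  have Mdim: "dim_col M = q" using M by (auto simp: poly_mat_space_def)
  have bc: "bs ! i \<in> carrier_vec q" if "i < length bs" for i
    using min that unfolding minimal_poly_basis_def by (meson nth_mem subsetD)
  have ind: "lin_indep q bs" using min unfolding minimal_poly_basis_def by blast
  define N where "N i = k - poly_vec_degree (bs ! i)" for i
  define I where "I = (SIGMA i:{..<length bs}. {..<N i})"
  define u where "u z = vec q (\<lambda>j. monom 1 (snd z) * bs ! fst z $ j)" for z
  define f where "f z = blocks_of_poly k q (u z)" for z
  have deg: "degree (monom 1 l * bs ! i $ j) < k" if "i < length bs" "l < N i" "j < q" for i l j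
    using degree_mult_le[of "monom 1 l" "bs ! i $ j"] degree_monom_le[of "1::'a" l]
      degree_le_poly_vec_degree[OF bc[OF that(1)] that(3)] that(2) unfolding N_def by linarith
  have f_index: "f z $ s = coeff (monom 1 (snd z) * bs ! fst z $ (s mod q)) (s div q)" if "s < k * q" for z s
    using that q by (simp add: f_def u_def blocks_of_poly_def)
  have poly_f: "poly_of_blocks k q (f (i, l)) j = monom 1 l * bs ! i $ j"
    if "i < length bs" "l < N i" "j < q" for i l j
    using poly_of_blocks_of_poly[of "u (i, l)" j k q] deg[OF that] that(3) by (simp add: f_def u_def)
  have "vectorspace.dim class_ring (V\<lparr>carrier := mat_kernel ?T\<rparr>) = card I"
  proof (rule dim_submodule_family)
    show "finite I" by (simp add: I_def)
    show "submodule class_ring (mat_kernel ?T) V" by (rule mat_kernel_submodule[OF Tc])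
    show "f ` I \<subseteq> mat_kernel ?T"
    proof
      fix x assume "x \<in> f ` I"
      then obtain i l where il: "i < length bs" "l < N i" and x: "x = f (i, l)" by (auto simp: I_def)
      have "bs ! i \<in> saturation q bs"
        using set_subset_saturation[of bs q] min il(1) unfolding minimal_poly_basis_def
        by (meson nth_mem subsetD)
      then have ker: "row_action M (\<lambda>j. bs ! i $ j) r = 0" if "r < m" for r
        using that unfolding sat by blast
      have "row_action M (poly_of_blocks k q x) r = 0" if "r < m" for r
      proof -
        have "row_action M (poly_of_blocks k q x) r = (\<Sum>j<q. monom 1 l * (M $$ (r, j) * bs ! i $ j))"
          unfolding row_action_def Mdim x by (rule sum.cong) (simp_all add: poly_f[OF il] mult_ac)
        also have "\<dots> = monom 1 l * row_action M (\<lambda>j. bs ! i $ j) r"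
          unfolding row_action_def Mdim by (simp add: sum_distrib_left)
        finally show ?thesis using ker[OF that] by simp
      qed
      moreover have "x \<in> carrier_vec (k * q)" by (simp add: x f_def blocks_of_poly_def)
      ultimately show "x \<in> mat_kernel ?T" using trimmed_sylvester_kernel[OF M d k] by blast
    qed
  next
    fix c assume c: "\<And>s. s < k * q \<Longrightarrow> (\<Sum>z\<in>I. c z * f z $ s) = 0"
    \<comment> \<open>Scalars attached to the shifts of one basis vector are gathered into a
      polynomial, turning a scalar relation into a polynomial one.\<close>
    define P where "P i = (\<Sum>l<N i. monom (c (i, l)) l)" for i
    have cP: "coeff (P i) l = (if l < N i then c (i, l) else 0)" for i l
      by (simp add: P_def coeff_sum)
    have "lin_comb P bs j = 0" if j: "j < q" for j
    proof (rule poly_eqI)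
      fix a
      have "coeff (lin_comb P bs j) a = (\<Sum>(i, l)\<in>I. coeff (P i) l * coeff (monom 1 l * bs ! i $ j) a)"
        unfolding I_def by (rule coeff_lin_comb_expand) (simp add: cP)
      also have "\<dots> = 0"
      proof (cases "a < k")
        case True
        have s: "a * q + j < k * q" using True j by (rule block_index_less)
        have "(\<Sum>(i, l)\<in>I. coeff (P i) l * coeff (monom 1 l * bs ! i $ j) a) = (\<Sum>z\<in>I. c z * f z $ (a * q + j))"
          using j by (intro sum.cong refl) (auto simp: I_def cP f_index[OF s])
        then show ?thesis using c[OF s] by simp
      next
        case False
        have "coeff (monom 1 l * bs ! i $ j) a = 0" if "i < length bs" "l < N i" for i l
          using deg[OF that j] False by (intro coeff_eq_0) simp
        then show ?thesis by (intro sum.neutral) (auto simp: I_def)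
      qed
      finally show "coeff (lin_comb P bs j) a = coeff 0 a" by simp
    qed
    then have P0: "P i = 0" if "i < length bs" for i
      using lin_indepD[OF ind, of P i] that by blast
    show "\<forall>z\<in>I. c z = 0"
    proof
      fix z assume "z \<in> I"
      then show "c z = 0" using P0[of "fst z"] cP[of "fst z" "snd z"] by (auto simp: I_def)
    qed
  next
    fix x assume "x \<in> mat_kernel ?T"
    then have x: "x \<in> carrier_vec (k * q)" and ker: "\<And>i. i < m \<Longrightarrow> row_action M (poly_of_blocks k q x) i = 0"
      using trimmed_sylvester_kernel[OF M d k] by blast+
    define v where "v = vec q (poly_of_blocks k q x)"
    have vc: "v \<in> carrier_vec q" by (simp add: v_def)
    have "row_action M (\<lambda>j. v $ j) i = row_action M (poly_of_blocks k q x) i" for i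
      by (simp add: row_action_def Mdim v_def)
    then have "v \<in> saturation q bs" unfolding sat using vc ker by simp
    from predictable_degree[OF min q this] obtain p where p: "\<And>j. j < q \<Longrightarrow> v $ j = lin_comb p bs j"
      and dp: "\<And>i. i < length bs \<Longrightarrow> p i \<noteq> 0 \<Longrightarrow> degree (p i) + poly_vec_degree (bs ! i) \<le> poly_vec_degree v"
      by blast
    have dv: "poly_vec_degree v \<le> k - 1"
      using vc q by (rule poly_vec_degree_le) (use degree_poly_of_blocks[OF k, of q x] in \<open>simp add: v_def\<close>)
    \<comment> \<open>Predictable degrees: \<open>v\<close> has degree at most \<open>k - 1\<close>,
      so a nonzero \<open>p i\<close> has degree below \<open>N i\<close> and only the shifts in
      \<open>I\<close> occur.\<close>
    have cz: "coeff (p i) l = 0" if i: "i < length bs" and l: "N i \<le> l" for i l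
    proof (cases "p i = 0")
      case False
      then show ?thesis using dp[OF i False] dv l k unfolding N_def by (intro coeff_eq_0) linarith
    qed simp
    have "x $ s = (\<Sum>z\<in>I. coeff (p (fst z)) (snd z) * f z $ s)" if s: "s < k * q" for s
    proof -
      have j: "s mod q < q" using q by simp
      have a: "s div q < k" using s by (simp add: less_mult_imp_div_less)
      have "x $ s = coeff (v $ (s mod q)) (s div q)"
        using j a by (simp add: v_def coeff_poly_of_blocks)
      also have "\<dots> = (\<Sum>(i, l)\<in>I. coeff (p i) l * coeff (monom 1 l * bs ! i $ (s mod q)) (s div q))"
        unfolding p[OF j] I_def by (rule coeff_lin_comb_expand) (rule cz)
      also have "\<dots> = (\<Sum>z\<in>I. coeff (p (fst z)) (snd z) * f z $ s)"
        by (intro sum.cong refl) (auto simp: f_index[OF s])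
      finally show ?thesis .
    qed
    then show "\<exists>c. \<forall>s<k * q. x $ s = (\<Sum>z\<in>I. c z * f z $ s)"
      by (intro exI[of _ "\<lambda>z. coeff (p (fst z)) (snd z)"]) simp
  qed
  moreover have "card I = (\<Sum>i<length bs. N i)" by (simp add: I_def)
  ultimately show ?thesis
    using vec_space.rank_nullity_mat[OF Tc] by (simp add: N_def)
qed

section \<open>Right minimal indices\<close>

lemma poly_part_mat_kernel:
  assumes M: "M \<in> carrier_mat m q"
  shows "poly_part q (mat_kernel (rat_mat M)) =
    {v \<in> carrier_vec q. \<forall>i<m. row_action M (\<lambda>j. v $ j) i = 0}"
proof -
  have "rat_mat M *\<^sub>v rat_vec v = 0\<^sub>v m \<longleftrightarrow> (\<forall>i<m. row_action M (\<lambda>j. v $ j) i = 0)"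
    if v: "v \<in> carrier_vec q" for v
  proof -
    have "(rat_mat M *\<^sub>v rat_vec v) $ i = to_fract (row_action M (\<lambda>j. v $ j) i)" if "i < m" for i
      using that M v by (simp add: row_action_def scalar_prod_def to_fract_sum to_fract_mult lessThan_atLeast0)
    then show ?thesis using M by (simp add: vec_eq_iff)
  qed
  then show ?thesis using M by (auto simp: poly_part_def mat_kernel_def)
qed

lemma is_minimal_basis_of_iff:
  fixes V :: "'a::field poly fract vec set"
  assumes V: "submodule class_ring V (module_vec TYPE('a poly fract) q)"
  shows "is_minimal_basis_of q V bs \<longleftrightarrow> minimal_poly_basis q bs \<and> saturation q bs = poly_part q V"
  unfolding is_minimal_basis_of_def is_poly_basis_iff[OF V] minimal_poly_basis_def
  by (auto simp: eq_commute)

lemma dim_poly_basis: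
  fixes V :: "'a::field poly fract vec set"
  assumes V: "submodule class_ring V (module_vec TYPE('a poly fract) q)" and bs: "is_poly_basis q V bs"
  shows "vectorspace.dim class_ring ((module_vec TYPE('a poly fract) q)\<lparr>carrier := V\<rparr>) = length bs"
proof -
  have vs: "vectorspace class_ring ((module_vec TYPE('a poly fract) q)\<lparr>carrier := V\<rparr>)"
    by (rule vec_space.submodule_vs[OF V])
  have "card (rat_vec ` set bs) = card (set bs)"
    by (intro card_image inj_onI) (simp add: map_vec_to_fract_inj)
  also have "\<dots> = length bs" using bs unfolding is_poly_basis_def by (simp add: distinct_card)
  finally show ?thesis
    using vectorspace.dim_basis[OF vs, of "rat_vec ` set bs"] bs unfolding is_poly_basis_def by simp
qed

text \<open>Each vector of a rational basis is multiplied by its own common denominator; nonzero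
  scaling preserves the basis property.\<close>

lemma poly_basis_exists:
  fixes W :: "'a::field poly fract vec set"
  assumes W: "submodule class_ring W (module_vec TYPE('a poly fract) q)"
    and finB: "finite B" and B: "vectorspace.basis class_ring ((module_vec TYPE('a poly fract) q)\<lparr>carrier := W\<rparr>) B"
  shows "\<exists>bs. is_poly_basis q W bs"
proof -
  interpret vec_space "TYPE('a poly fract)" q .
  have Wc: "W \<subseteq> carrier_vec q" using submodule.subset[OF W] by (simp only: module_vec_simps)
  obtain xs where xs: "set xs = B" "distinct xs" using finite_distinct_list[OF finB] by blast
  define I where "I = {..<length xs}"
  have finI: "finite I" by (simp add: I_def)
  have "(!) xs ` I = B" using xs by (auto simp: I_def set_conv_nth)
  moreover have "inj_on ((!) xs) I" using xs by (intro inj_on_nth) (auto simp: I_def)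
  ultimately have "inj_on ((!) xs) I \<and> vectorspace.basis class_ring (V\<lparr>carrier := W\<rparr>) ((!) xs ` I)"
    using B by (simp only:)
  then have sub: "(!) xs ` I \<subseteq> W"
    and ind: "\<And>c. \<forall>j<q. (\<Sum>i\<in>I. c i * xs ! i $ j) = 0 \<Longrightarrow> \<forall>i\<in>I. c i = 0"
    and gen: "\<And>v. v \<in> W \<Longrightarrow> \<exists>c. \<forall>j<q. v $ j = (\<Sum>i\<in>I. c i * xs ! i $ j)"
    unfolding basis_family_iff[OF finI W] by blast+
  have "\<exists>s p. s \<noteq> 0 \<and> (\<forall>j<q. to_fract s * xs ! i $ j = to_fract (p j))" for i
    by (rule common_denominator)
  then obtain s p where s: "\<And>i. s i \<noteq> 0"
    and p: "\<And>i j. j < q \<Longrightarrow> to_fract (s i) * xs ! i $ j = to_fract (p i j)" by metis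
  define bs where "bs = map (\<lambda>i. vec q (p i)) [0..<length xs]"
  define f where "f = (\<lambda>i. rat_vec (bs ! i))"
  have len: "{..<length bs} = I" by (simp add: bs_def I_def)
  have f: "f i $ j = to_fract (s i) * xs ! i $ j" if "i \<in> I" "j < q" for i j
    using that p by (simp add: f_def bs_def I_def)
  have s': "to_fract (s i) \<noteq> 0" for i using s by simp
  have "inj_on f I \<and> vectorspace.basis class_ring (V\<lparr>carrier := W\<rparr>) (f ` I)"
    unfolding basis_family_iff[OF finI W]
  proof (intro conjI allI impI ballI)
    show "f ` I \<subseteq> W"
    proof
      fix x assume "x \<in> f ` I"
      then obtain i where i: "i \<in> I" and x: "x = f i" by blast
      have xi: "xs ! i \<in> W" using sub i by blast
      have "x = to_fract (s i) \<cdot>\<^sub>v xs ! i"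
        using xi Wc i f[OF i] by (intro eq_vecI) (auto simp: x f_def bs_def I_def)
      also have "\<dots> \<in> W" using submodule.smult_closed[OF W _ xi, of "to_fract (s i)"] by simp
      finally show "x \<in> W" .
    qed
  next
    fix c i assume c: "\<forall>j<q. (\<Sum>i\<in>I. c i * f i $ j) = 0" and i: "i \<in> I"
    have "(\<Sum>i\<in>I. c i * to_fract (s i) * xs ! i $ j) = 0" if j: "j < q" for j
    proof -
      have "(\<Sum>i\<in>I. c i * to_fract (s i) * xs ! i $ j) = (\<Sum>i\<in>I. c i * f i $ j)"
        by (rule sum.cong) (simp_all add: f j mult.assoc)
      then show ?thesis using c j by simp
    qed
    then have "\<forall>i\<in>I. c i * to_fract (s i) = 0" by (intro ind) simp
    then show "c i = 0" using i s'[of i] by (metis mult_eq_0_iff)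
  next
    fix v assume "v \<in> W"
    then obtain c where c: "\<And>j. j < q \<Longrightarrow> v $ j = (\<Sum>i\<in>I. c i * xs ! i $ j)" using gen by blast
    have "v $ j = (\<Sum>i\<in>I. c i / to_fract (s i) * f i $ j)" if j: "j < q" for j
      unfolding c[OF j] by (rule sum.cong) (use s' in \<open>simp_all add: f j\<close>)
    then show "\<exists>c. \<forall>j<q. v $ j = (\<Sum>i\<in>I. c i * f i $ j)"
      by (intro exI[of _ "\<lambda>i. c i / to_fract (s i)"]) simp
  qed
  then have "is_poly_basis q W bs" unfolding is_poly_basis_family len f_def .
  then show ?thesis ..
qed

text \<open>Degree sums are natural numbers, so a least one is attained. This justifies the choice
  operator in \<open>minimal_indices\<close>.\<close>

lemma minimal_basis_of_kernel_exists:
  fixes M :: "'a::field poly mat"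
  assumes M: "M \<in> carrier_mat m q"
  shows "\<exists>bs. is_minimal_basis_of q (mat_kernel (rat_mat M)) bs"
proof -
  have R: "rat_mat M \<in> carrier_mat m q" using M by simp
  obtain B where "finite B" "kernel.basis q (rat_mat M) B" using kernel_basis_exists[OF R] by blast
  then obtain cs where "is_poly_basis q (mat_kernel (rat_mat M)) cs"
    using poly_basis_exists[OF mat_kernel_submodule[OF R]] by blast
  then have "\<exists>bs. is_poly_basis q (mat_kernel (rat_mat M)) bs \<and>
      (\<forall>cs. is_poly_basis q (mat_kernel (rat_mat M)) cs \<longrightarrow>
        sum_list (map poly_vec_degree bs) \<le> sum_list (map poly_vec_degree cs))"
    by (rule ex_has_least_nat)
  then show ?thesis unfolding is_minimal_basis_of_def .
qed

section \<open>From truncated sums to multiplicities\<close>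

lemma sum_list_diff_Suc:
  "sum_list (map (\<lambda>e. Suc k - e) es) = sum_list (map (\<lambda>e. k - e) es) + length (filter (\<lambda>e. e \<le> k) es)"
  by (induction es) (auto simp: Suc_diff_le)

lemma count_list_filter_le:
  "length (filter (\<lambda>e. e \<le> Suc j) es) = count_list es (Suc j) + length (filter (\<lambda>e. e \<le> j) es)"
  by (induction es) auto

lemma count_list_0_filter: "length (filter (\<lambda>e. e \<le> 0) es) = count_list es (0::nat)"
  by (induction es) auto

text \<open>First differences of the left side in \<open>k\<close> count the entries \<le> k, second
  differences are multiplicities. The right side has increments 0 before \<open>k' - 1\<close>, then
  \<open>t\<close> once, then always \<open>n\<close>. The converse evaluates a sum over the two
  possible entries.\<close>

lemma sum_list_truncated_iff:
  fixes es :: "nat list"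
  assumes t: "n * k' = \<sigma> + t" "t < n" and k': "0 < k'"
  shows "(\<forall>k\<ge>1. sum_list (map (\<lambda>e. k - e) es) = k * n - \<sigma>) \<longleftrightarrow>
    count_list es (k' - 1) = t \<and> count_list es k' = n - t \<and> (\<forall>j. j \<notin> {k' - 1, k'} \<longrightarrow> count_list es j = 0)"
    (is "?L \<longleftrightarrow> ?R")
proof
  assume L: ?L
  \<comment> \<open>Both sides vanish at \<open>k = 0\<close>, so the differences may start
    there.\<close>
  have h: "sum_list (map (\<lambda>e. k - e) es) = k * n - \<sigma>" for k
    using L by (cases k) auto
  define c where "c j = length (filter (\<lambda>e. e \<le> j) es)" for j
  have c: "c j = (Suc j * n - \<sigma>) - (j * n - \<sigma>)" for j
    using sum_list_diff_Suc[of j es] unfolding h c_def by linarith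
  have small: "c j = 0" if "Suc j < k'" for j
  proof -
    have "Suc (Suc j) * n \<le> k' * n" using that by (intro mult_le_mono1) simp
    then have "Suc j * n \<le> \<sigma>" using t by (simp add: mult.commute)
    then show ?thesis unfolding c by simp
  qed
  \<comment> \<open>Truncation makes the term at \<open>k' - 1\<close> zero, while the one at
    \<open>k'\<close> is k' n - \<sigma> = t.\<close>
  have mid: "c (k' - 1) = t"
  proof -
    have "(k' - 1) * n + n = \<sigma> + t" using t k' by (cases k') (auto simp: mult.commute)
    then show ?thesis unfolding c using t k' by (simp add: mult.commute)
  qed
  have big: "c j = n" if "k' \<le> j" for j
  proof -
    have "k' * n \<le> j * n" using that by simp
    moreover have "\<sigma> \<le> k' * n" using t(1) by (simp add: mult.commute)
    ultimately have "\<sigma> \<le> j * n" by (rule order_trans[rotated])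
    then show ?thesis unfolding c by simp
  qed
  have step: "count_list es (Suc j) = c (Suc j) - c j" and zero: "count_list es 0 = c 0" for j
    unfolding c_def using count_list_filter_le[of j es] count_list_0_filter[of es] by simp_all
  show ?R
  proof (intro conjI allI impI)
    show "count_list es (k' - 1) = t"
    proof (cases "k' - 1")
      case 0
      then show ?thesis using mid zero by simp
    next
      case (Suc l)
      then show ?thesis using mid step[of l] small[of l] by simp
    qed
    show "count_list es k' = n - t"
      using step[of "k' - 1"] big[of k'] mid k' by simp
    fix j assume j: "j \<notin> {k' - 1, k'}"
    show "count_list es j = 0"
    proof (cases j)
      case 0
      then show ?thesis using zero small[of 0] j k' by auto
    next
      case (Suc i)
      consider "Suc j < k'" | "k' \<le> i" using j Suc by fastforce
      then show ?thesis using Suc step[of i] small[of j] small[of i] big[of j] big[of i] by cases auto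
    qed
  qed
next
  assume R: ?R
  then have sub: "set es \<subseteq> {k' - 1, k'}" by (auto simp: count_list_0_iff)
  show ?L
  proof (intro allI impI)
    fix k :: nat
    have "sum_list (map (\<lambda>e. k - e) es) = t * (k - (k' - 1)) + (n - t) * (k - k')"
      using sum_list_map_eq_sum_count2[OF sub, of "\<lambda>e. k - e"] R k' by simp
    also have "\<dots> = k * n - \<sigma>"
    proof (cases "k' \<le> k")
      case True
      then obtain l where l: "k = k' + l" using le_Suc_ex by blast
      have "t * (k - (k' - 1)) + (n - t) * (k - k') = t + (t + (n - t)) * l"
        using l k' by (simp add: algebra_simps Suc_diff_le)
      also have "\<dots> = t + n * l" using t by simp
      also have "\<dots> = k * n - \<sigma>" using t l by (simp add: algebra_simps)
      finally show ?thesis .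
    next
      case False
      then have "Suc k * n \<le> k' * n" by (intro mult_le_mono1) simp
      then have "k * n \<le> \<sigma>" using t by (simp add: mult.commute)
      then show ?thesis using False by simp
    qed
    finally show "sum_list (map (\<lambda>e. k - e) es) = k * n - \<sigma>" .
  qed
qed

lemma rank_trimmed_sylvester_kernel_basis:
  fixes M :: "'a::field poly mat"
  assumes M: "M \<in> poly_mat_space d m q" and d: "length d = m" and k: "0 < k" and q: "0 < q"
    and bs: "is_minimal_basis_of q (mat_kernel (rat_mat M)) bs"
  shows "vec_space.rank (k * m + sum_list d) (trimmed_sylvester_mat d k M) +
    sum_list (map (\<lambda>e. k - e) (map poly_vec_degree bs)) = k * q"
proof -
  have Mc: "M \<in> carrier_mat m q" using M by (simp add: poly_mat_space_def)
  then have R: "rat_mat M \<in> carrier_mat m q" by simp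
  have "minimal_poly_basis q bs"
    and "saturation q bs = {v \<in> carrier_vec q. \<forall>i<m. row_action M (\<lambda>j. v $ j) i = 0}"
    using bs unfolding is_minimal_basis_of_iff[OF mat_kernel_submodule[OF R]] poly_part_mat_kernel[OF Mc]
    by blast+
  from rank_trimmed_sylvester[OF M d k q this] show ?thesis
    by (simp add: sum_list_sum_nth lessThan_atLeast0)
qed

text \<open>Full rank prescribes the nullity k(m + n) - min(km + \<sigma>, k(m + n)) = max(0, kn -
  \<sigma>), which truncated subtraction writes without a case distinction.\<close>

lemma full_trimmed_sylvester_rank_iff:
  fixes M :: "'a::field poly mat"
  assumes M: "M \<in> poly_mat_space d m (m + n)" and d: "length d = m" and m: "0 < m"
    and bs: "is_minimal_basis_of (m + n) (mat_kernel (rat_mat M)) bs"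
  shows "full_trimmed_sylvester_rank d M \<longleftrightarrow>
    (\<forall>k\<ge>1. sum_list (map (\<lambda>e. k - e) (map poly_vec_degree bs)) = k * n - sum_list d)"
proof -
  have dims: "dim_row M = m" "dim_col M = m + n" using M by (auto simp: poly_mat_space_def)
  have "vec_space.rank (k * m + sum_list d) (trimmed_sylvester_mat d k M)
      = min (k * m + sum_list d) (k * (m + n)) \<longleftrightarrow>
    sum_list (map (\<lambda>e. k - e) (map poly_vec_degree bs)) = k * n - sum_list d" if "1 \<le> k" for k
  proof -
    have "0 < k" "0 < m + n" using that m by simp_all
    from rank_trimmed_sylvester_kernel_basis[OF M d this bs] show ?thesis
      unfolding add_mult_distrib2 by linarith
  qed
  then show ?thesis unfolding full_trimmed_sylvester_rank_def dims by simp
qed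

section \<open>Row spaces and orthogonality\<close>

lemma (in vec_space) submodule_eqI:
  assumes W1: "submodule class_ring W1 V" and W2: "submodule class_ring W2 V" and sub: "W1 \<subseteq> W2"
    and B: "finite B" "vectorspace.basis class_ring (V\<lparr>carrier := W1\<rparr>) B"
    and C: "finite C" "vectorspace.basis class_ring (V\<lparr>carrier := W2\<rparr>) C"
    and card: "card B = card C"
  shows "W1 = W2"
proof -
  have vs1: "vectorspace class_ring (vs W1)" and vs2: "vectorspace class_ring (vs W2)"
    using submodule_vs W1 W2 by blast+
  have B1: "B \<subseteq> W1" using B(2) unfolding vectorspace.basis_def[OF vs1] by simp
  then have B2: "B \<subseteq> W2" using sub by (rule subset_trans)
  have li: "lin_indpt B" and sp: "span B = W1"
    using B(2) unfolding basis_submodule_iff[OF W1 B1] by blast+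
  have fd: "vectorspace.fin_dim class_ring (vs W2)"
    using C unfolding vectorspace.fin_dim_def[OF vs2] vectorspace.basis_def[OF vs2] by blast
  have dim: "vectorspace.dim class_ring (vs W2) = card B"
    using vectorspace.dim_basis[OF vs2 C] card by simp
  have "vectorspace.basis class_ring (vs W2) B"
  proof (rule vectorspace.dim_li_is_basis[OF vs2 fd B(1)])
    show "B \<subseteq> carrier (vs W2)" using B2 by simp
    show "LinearCombinations.module.lin_indpt class_ring (vs W2) B"
      using span_li_not_depend(2)[OF B2 W2] li by simp
    show "vectorspace.dim class_ring (vs W2) \<le> card B" using dim by simp
  qed
  then show ?thesis using sp unfolding basis_submodule_iff[OF W2 B2] by simp
qed

lemma poly_basis_subspace_eq:
  fixes V W :: "'a::field poly fract vec set"
  assumes V: "submodule class_ring V (module_vec TYPE('a poly fract) q)"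
    and W: "submodule class_ring W (module_vec TYPE('a poly fract) q)"
    and sub: "V \<subseteq> W" and bs: "is_poly_basis q V bs" and cs: "is_poly_basis q W cs"
    and len: "length bs = length cs"
  shows "V = W"
proof -
  have card: "card (rat_vec ` set xs) = length xs" if "distinct xs" for xs :: "'a poly vec list"
    using that by (subst card_image) (auto intro!: inj_onI simp: map_vec_to_fract_inj distinct_card)
  show ?thesis
    by (rule vec_space.submodule_eqI[OF V W sub, of "rat_vec ` set bs" "rat_vec ` set cs"])
      (use bs cs len card in \<open>auto simp: is_poly_basis_def\<close>)
qed

lemma row_space_submodule:
  fixes M :: "'a::field poly mat"
  assumes "M \<in> carrier_mat m q"
  shows "submodule class_ring (vec_space.row_space q (rat_mat M)) (module_vec TYPE('a poly fract) q)"
proof -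
  interpret vec_space "TYPE('a poly fract)" q .
  have "set (rows (rat_mat M)) \<subseteq> carrier_vec q" using assms by (auto simp: rows_def)
  then show ?thesis unfolding row_space_def by (rule span_is_submodule)
qed

text \<open>A preimage of the \<open>i\<close>-th unit vector pairs to 1 with row \<open>i\<close>
  and to 0 with the others, so pairing a relation among the rows with it isolates the
  \<open>i\<close>-th coefficient.\<close>

lemma surj_rows_poly_basis:
  fixes M :: "'a::field poly mat"
  assumes M: "M \<in> carrier_mat m q" and surj: "\<forall>y\<in>carrier_vec m. \<exists>x\<in>carrier_vec q. rat_mat M *\<^sub>v x = y"
  shows "is_poly_basis q (vec_space.row_space q (rat_mat M)) (rows M)"
proof -
  interpret vec_space "TYPE('a poly fract)" q .
  define f where "f = (\<lambda>i. rat_vec (rows M ! i))"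
  have f: "f i = row (rat_mat M) i" if "i < m" for i
    using that M by (intro eq_vecI) (simp_all add: f_def)
  have img: "f ` {..<m} = set (rows (rat_mat M))"
    using f M by (auto simp: rows_def image_def)
  have fc: "f ` {..<m} \<subseteq> carrier_vec q" unfolding img using M by (auto simp: rows_def)
  have ind: "\<forall>i\<in>{..<m}. c i = 0" if c: "\<forall>j<q. (\<Sum>i<m. c i * f i $ j) = 0" for c
  proof
    fix i assume "i \<in> {..<m}"
    then have i: "i < m" by simp
    obtain x where x: "x \<in> carrier_vec q" "rat_mat M *\<^sub>v x = unit_vec m i"
      using surj unit_vec_carrier by blast
    have Mx: "(\<Sum>j<q. f l $ j * x $ j) = (if l = i then 1 else 0)" if "l < m" for l
    proof -
      have "(\<Sum>j<q. f l $ j * x $ j) = (rat_mat M *\<^sub>v x) $ l"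
        using that M x(1) f[OF that] by (simp add: scalar_prod_def lessThan_atLeast0)
      then show ?thesis using that i by (simp add: x(2))
    qed
    have "c i = (\<Sum>l<m. c l * (if l = i then 1 else 0))"
      using i by (simp add: if_distrib[of "\<lambda>y. c _ * y"] cong: if_cong)
    also have "\<dots> = (\<Sum>l<m. c l * (\<Sum>j<q. f l $ j * x $ j))"
      by (rule sum.cong) (simp_all add: Mx)
    also have "\<dots> = (\<Sum>l<m. \<Sum>j<q. c l * f l $ j * x $ j)" by (simp add: sum_distrib_left mult.assoc)
    also have "\<dots> = (\<Sum>j<q. \<Sum>l<m. c l * f l $ j * x $ j)" by (rule sum.swap)
    also have "\<dots> = (\<Sum>j<q. (\<Sum>l<m. c l * f l $ j) * x $ j)" by (simp add: sum_distrib_right)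
    also have "\<dots> = 0" using c by simp
    finally show "c i = 0" .
  qed
  have inj: "inj_on f {..<m}" and li: "lin_indpt (f ` {..<m})"
    using indep_family[OF finite_lessThan fc] ind by blast+
  have "f ` {..<m} \<subseteq> row_space (rat_mat M)"
    unfolding row_space_def img[symmetric] using in_own_span[of "f ` {..<m}"] fc by simp
  then have "vectorspace.basis class_ring (V\<lparr>carrier := row_space (rat_mat M)\<rparr>) (f ` {..<m})"
    using basis_submodule_iff[OF row_space_submodule[OF M]] li unfolding row_space_def img[symmetric] by blast
  then show ?thesis using inj M unfolding is_poly_basis_family f_def by simp
qed

text \<open>The pairing is linear and the multiplier \<open>s\<close> cancels. Hence lists with
  equal saturations have the same right null vectors.\<close>

lemma saturation_orthogonal:
  fixes ws :: "'a::idom vec list"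
  assumes w: "w \<in> saturation q ws" and orth: "\<And>u. u \<in> set ws \<Longrightarrow> (\<Sum>j<q. u $ j * v $ j) = 0"
  shows "(\<Sum>j<q. w $ j * v $ j) = 0"
proof -
  obtain s c where s: "s \<noteq> 0" and c: "\<And>j. j < q \<Longrightarrow> s * w $ j = lin_comb c ws j"
    using w unfolding saturation_def by blast
  have "s * (\<Sum>j<q. w $ j * v $ j) = (\<Sum>j<q. lin_comb c ws j * v $ j)"
    unfolding sum_distrib_left by (rule sum.cong) (simp_all add: c[symmetric] mult.assoc)
  also have "\<dots> = (\<Sum>j<q. \<Sum>i<length ws. c i * (ws ! i $ j * v $ j))"
    by (simp add: lin_comb_def sum_distrib_right mult.assoc)
  also have "\<dots> = (\<Sum>i<length ws. \<Sum>j<q. c i * (ws ! i $ j * v $ j))" by (rule sum.swap)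
  also have "\<dots> = (\<Sum>i<length ws. c i * (\<Sum>j<q. ws ! i $ j * v $ j))" by (simp only: sum_distrib_left)
  also have "\<dots> = 0" using orth by simp
  finally show ?thesis using s by simp
qed

lemma ceiling_quotient_remainder:
  assumes n: "0 < n" and k': "k' = nat \<lceil>real \<sigma> / real n\<rceil>" and t: "n * k' = \<sigma> + t"
  shows "t < n"
proof -
  have "real k' = of_int \<lceil>real \<sigma> / real n\<rceil>"
    unfolding k' by (intro of_nat_nat) (simp add: less_le_trans[of "- 1" 0])
  then have "real k' < real \<sigma> / real n + 1" using ceiling_correct[of "real \<sigma> / real n"] by linarith
  then have "real n * real k' < real \<sigma> + real n" using n by (simp add: field_simps)
  then have "n * k' < \<sigma> + n" by (simp flip: of_nat_mult of_nat_add)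
  then show ?thesis using t by simp
qed

lemma count_list_sort: "count_list (sort xs) x = count_list xs x"
  by (metis count_mset mset_sort)

section \<open>Consequences of full trimmed Sylvester rank\<close>

lemma rank_leading_row_coeff_mat:
  fixes M :: "'a::field poly mat"
  assumes M: "M \<in> poly_mat_space d m q" and d: "length d = m" and k: "0 < k"
    and full: "vec_space.rank (k * m + sum_list d) (trimmed_sylvester_mat d k M) = k * m + sum_list d"
  shows "vec_space.rank m (leading_row_coeff_mat d M) = m"
proof -
  have L: "leading_row_coeff_mat d M \<in> carrier_mat m q"
    using M by (auto simp: leading_row_coeff_mat_def poly_mat_space_def)
  show ?thesis
    using full leading_coeff_surj[OF M d k]
    unfolding vec_space.rank_eq_nr_iff[OF L] vec_space.rank_eq_nr_iff[OF trimmed_sylvester_mult(1)[OF M d k]]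
    by blast
qed

text \<open>A preimage of the \<open>i\<close>-th unit vector shows that row \<open>i\<close> of the
  leading coefficient matrix is nonzero, so some entry attains the degree bound.\<close>

lemma row_degree_of_leading_rank:
  fixes M :: "'a::field poly mat"
  assumes M: "M \<in> poly_mat_space d m q" and full: "vec_space.rank m (leading_row_coeff_mat d M) = m"
    and i: "i < m"
  shows "poly_vec_degree (row M i) = d ! i"
proof -
  have Mc: "M \<in> carrier_mat m q" and deg: "\<And>j. j < q \<Longrightarrow> degree (M $$ (i, j)) \<le> d ! i"
    using M i by (auto simp: poly_mat_space_def)
  then have L: "leading_row_coeff_mat d M \<in> carrier_mat m q"
    by (auto simp: leading_row_coeff_mat_def)
  obtain x where x: "x \<in> carrier_vec q" "leading_row_coeff_mat d M *\<^sub>v x = unit_vec m i"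
    using full unfolding vec_space.rank_eq_nr_iff[OF L] by (meson unit_vec_carrier)
  have "(\<Sum>j<q. coeff (M $$ (i, j)) (d ! i) * x $ j) = (leading_row_coeff_mat d M *\<^sub>v x) $ i"
    using Mc i x(1) by (simp add: leading_row_coeff_mat_def scalar_prod_def lessThan_atLeast0)
  also have "\<dots> = 1" using i by (simp add: x(2))
  finally obtain j where j: "j < q" "coeff (M $$ (i, j)) (d ! i) \<noteq> 0"
    by (metis (no_types, lifting) lessThan_iff mult_zero_left sum.neutral zero_neq_one)
  have rc: "row M i \<in> carrier_vec q" using Mc by (auto simp: row_def)
  have "d ! i \<le> degree (row M i $ j)" using j i Mc le_degree by auto
  also have "\<dots> \<le> poly_vec_degree (row M i)" by (rule degree_le_poly_vec_degree[OF rc j(1)])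
  finally show ?thesis
    using poly_vec_degree_le[OF rc, of "d ! i"] j(1) deg i Mc by fastforce
qed

lemma rank_rat_mat_of_kernel_basis:
  fixes M :: "'a::field poly mat"
  assumes M: "M \<in> carrier_mat m (m + n)" and bs: "is_poly_basis (m + n) (mat_kernel (rat_mat M)) bs"
    and len: "length bs = n"
  shows "vec_space.rank m (rat_mat M) = m"
proof -
  have R: "rat_mat M \<in> carrier_mat m (m + n)" using M by simp
  show ?thesis
    using vec_space.rank_nullity_mat[OF R] dim_poly_basis[OF mat_kernel_submodule[OF R] bs] len by simp
qed

text \<open>Any other polynomial basis of the row space has the same right kernel, and its trimmed
  Sylvester matrices have at least as many rows as their rank, which is determined by that kernel.\<close>

lemma row_degree_sum_lower_bound:
  fixes M :: "'a::field poly mat"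
  assumes M: "M \<in> carrier_mat m (m + n)" and m: "0 < m"
    and surj: "\<forall>y\<in>carrier_vec m. \<exists>x\<in>carrier_vec (m + n). rat_mat M *\<^sub>v x = y"
    and bs: "is_minimal_basis_of (m + n) (mat_kernel (rat_mat M)) bs"
    and k: "0 < k" and h: "sum_list (map (\<lambda>e. k - e) (map poly_vec_degree bs)) + \<sigma> = k * n"
    and cs: "is_poly_basis (m + n) (vec_space.row_space (m + n) (rat_mat M)) cs"
  shows "\<sigma> \<le> sum_list (map poly_vec_degree cs)"
proof -
  let ?q = "m + n"
  let ?e = "map poly_vec_degree cs"
  note RS = row_space_submodule[OF M]
  have rows: "is_poly_basis ?q (vec_space.row_space ?q (rat_mat M)) (rows M)"
    by (rule surj_rows_poly_basis[OF M surj])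
  have len: "length cs = m"
    using dim_poly_basis[OF RS rows] dim_poly_basis[OF RS cs] M by simp
  have cc: "set cs \<subseteq> carrier_vec ?q" and satc: "saturation ?q cs = saturation ?q (rows M)"
    and rc: "set (rows M) \<subseteq> carrier_vec ?q"
    using cs rows unfolding is_poly_basis_iff[OF RS] by auto
  define P where "P = mat_of_rows ?q cs"
  have Pc: "P \<in> carrier_mat m ?q" using len by (auto simp: P_def)
  have Prow: "P $$ (i, j) = cs ! i $ j" if "i < m" "j < ?q" for i j
    using that len by (simp add: P_def mat_of_rows_index)
  have P: "P \<in> poly_mat_space ?e m ?q"
    using Pc len cc by (auto simp: poly_mat_space_def Prow intro!: degree_le_poly_vec_degree)
  have actP: "row_action P (\<lambda>j. v $ j) i = (\<Sum>j<?q. cs ! i $ j * v $ j)" if "i < m" for v i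
    using Pc by (simp add: row_action_def Prow[OF that])
  have actM: "row_action M (\<lambda>j. v $ j) i = (\<Sum>j<?q. rows M ! i $ j * v $ j)" if "i < m" for v i
    using M that by (simp add: row_action_def)
  have "(\<forall>i<m. row_action P (\<lambda>j. v $ j) i = 0) \<longleftrightarrow> (\<forall>i<m. row_action M (\<lambda>j. v $ j) i = 0)" for v
  proof
    assume "\<forall>i<m. row_action P (\<lambda>j. v $ j) i = 0"
    then have o: "(\<Sum>j<?q. u $ j * v $ j) = 0" if "u \<in> set cs" for u
      using that len by (auto simp: actP in_set_conv_nth)
    have "rows M ! i \<in> saturation ?q cs" if "i < m" for i
      using set_subset_saturation[OF rc] that M nth_mem[of i "rows M"] unfolding satc by auto
    then show "\<forall>i<m. row_action M (\<lambda>j. v $ j) i = 0"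
      using saturation_orthogonal[where ws = cs and v = v, OF _ o] by (simp add: actM)
  next
    assume "\<forall>i<m. row_action M (\<lambda>j. v $ j) i = 0"
    then have o: "(\<Sum>j<?q. u $ j * v $ j) = 0" if "u \<in> set (rows M)" for u
      using that M actM by (metis carrier_matD(1) in_set_conv_nth length_rows)
    have "cs ! i \<in> saturation ?q (rows M)" if "i < m" for i
      using set_subset_saturation[OF cc] that len nth_mem[of i cs] unfolding satc by auto
    then show "\<forall>i<m. row_action P (\<lambda>j. v $ j) i = 0"
      using saturation_orthogonal[where ws = "rows M" and v = v, OF _ o] by (simp add: actP)
  qed
  then have eq: "poly_part ?q (mat_kernel (rat_mat P)) = poly_part ?q (mat_kernel (rat_mat M))"
    unfolding poly_part_mat_kernel[OF Pc] poly_part_mat_kernel[OF M] by simp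
  have R: "rat_mat M \<in> carrier_mat m ?q" "rat_mat P \<in> carrier_mat m ?q" using M Pc by simp_all
  have "is_minimal_basis_of ?q (mat_kernel (rat_mat P)) bs"
    using bs unfolding is_minimal_basis_of_iff[OF mat_kernel_submodule[OF R(1)]]
      is_minimal_basis_of_iff[OF mat_kernel_submodule[OF R(2)]] eq .
  then have "vec_space.rank (k * m + sum_list ?e) (trimmed_sylvester_mat ?e k P) +
      sum_list (map (\<lambda>e. k - e) (map poly_vec_degree bs)) = k * ?q"
    using rank_trimmed_sylvester_kernel_basis[OF P _ k] len m by simp
  moreover have "vec_space.rank (k * m + sum_list ?e) (trimmed_sylvester_mat ?e k P) \<le> k * m + sum_list ?e"
    using vec_space.rank_le_nr[OF trimmed_sylvester_mult(1)[OF P _ k]] len by simp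
  \<comment> \<open>With S the truncated sum: rank + S = k(m + n), S + \<sigma> = kn, and the rank
    is at most km plus the degree sum of \<open>cs\<close>.\<close>
  ultimately show ?thesis using h unfolding add_mult_distrib2 by linarith
qed

text \<open>The zero product puts the rows of \<open>N\<close> into the kernel, and there are as
  many of them as its dimension \<open>n\<close>, so the row space of \<open>N\<close> is the whole
  kernel and minimality transfers.\<close>

lemma dual_rows_minimal_basis_of_kernel:
  fixes M N :: "'a::field poly mat"
  assumes M: "M \<in> carrier_mat m (m + n)" and bs: "is_poly_basis (m + n) (mat_kernel (rat_mat M)) bs"
    and len: "length bs = n" and dual: "dual_minimal_bases M N"
  shows "is_minimal_basis_of (m + n) (mat_kernel (rat_mat M)) (rows N)"
proof -
  let ?q = "m + n"
  have dims: "dim_row M = m" "dim_col M = ?q" using M by auto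
  have Nc: "N \<in> carrier_mat n ?q" using dual dims by (auto simp: dual_minimal_bases_def)
  then have dimN: "dim_col N = ?q" "dim_row N = n" by auto
  have MN: "M * transpose_mat N = 0\<^sub>m m n" using dual dims dimN by (simp only: dual_minimal_bases_def)
  have min: "is_minimal_basis_of ?q (vec_space.row_space ?q (rat_mat N)) (rows N)"
    using dual unfolding dual_minimal_bases_def is_minimal_basis_def dimN by blast
  have R: "rat_mat M \<in> carrier_mat m ?q" using M by simp
  note K = mat_kernel_submodule[OF R]
  interpret vec_space "TYPE('a poly fract)" ?q .
  have "set (rows (rat_mat N)) \<subseteq> mat_kernel (rat_mat M)"
  proof
    fix x assume "x \<in> set (rows (rat_mat N))"
    then obtain l where l: "l < n" and x: "x = row (rat_mat N) l" using Nc by (auto simp: rows_def)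
    have "(rat_mat M *\<^sub>v x) $ i = 0" if i: "i < m" for i
    proof -
      have "(rat_mat M *\<^sub>v x) $ i = to_fract ((M * transpose_mat N) $$ (i, l))"
        using i l M Nc by (simp add: x scalar_prod_def to_fract_sum to_fract_mult)
      then show ?thesis using i l by (simp add: MN)
    qed
    then have "rat_mat M *\<^sub>v x = 0\<^sub>v m" using M by (intro eq_vecI) simp_all
    moreover have "x \<in> carrier_vec ?q" using Nc by (auto simp: x row_def)
    ultimately show "x \<in> mat_kernel (rat_mat M)" by (intro mat_kernelI[OF R])
  qed
  then have sub: "row_space (rat_mat N) \<subseteq> mat_kernel (rat_mat M)"
    unfolding row_space_def by (rule span_is_subset[OF _ K])
  have "is_poly_basis ?q (row_space (rat_mat N)) (rows N)"
    using min by (simp add: is_minimal_basis_of_def)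
  from poly_basis_subspace_eq[OF row_space_submodule[OF Nc] K sub this bs] len Nc
  have "row_space (rat_mat N) = mat_kernel (rat_mat M)" by simp
  then show ?thesis using min by simp
qed

lemma poly_mat_degree_eqI:
  assumes N: "N \<in> carrier_mat r q" and q: "0 < q"
    and le: "\<And>e. e \<in> set (map poly_vec_degree (rows N)) \<Longrightarrow> e \<le> D"
    and mem: "D \<in> set (map poly_vec_degree (rows N))"
  shows "poly_mat_degree N = D"
  unfolding poly_mat_degree_def
proof (rule Max_eqI)
  have eq: "{degree (N $$ (i, j)) |i j. i < dim_row N \<and> j < dim_col N} =
      (\<lambda>(i, j). degree (N $$ (i, j))) ` ({..<dim_row N} \<times> {..<dim_col N})" by auto
  then show "finite {degree (N $$ (i, j)) |i j. i < dim_row N \<and> j < dim_col N}" by simp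
  have rc: "row N i \<in> carrier_vec q" for i using N by (auto simp: row_def)
  show "y \<le> D" if y: "y \<in> {degree (N $$ (i, j)) |i j. i < dim_row N \<and> j < dim_col N}" for y
  proof -
    obtain i j where ij: "i < r" "j < q" and y: "y = degree (N $$ (i, j))" using y N by auto
    have "y = degree (row N i $ j)" using ij N by (simp add: y)
    also have "\<dots> \<le> poly_vec_degree (row N i)" by (rule degree_le_poly_vec_degree[OF rc ij(2)])
    also have "\<dots> \<le> D" using ij(1) N by (intro le) (auto simp: rows_def)
    finally show ?thesis .
  qed
  obtain i where i: "i < r" and D: "D = poly_vec_degree (row N i)" using mem N by (auto simp: rows_def)
  have "dim_vec (row N i) = q" using N by simp
  then have "D \<in> {degree (row N i $ j) |j. j < q}"
    unfolding D poly_vec_degree_def using q Max_in[of "{degree (row N i $ j) |j. j < q}"] by auto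
  then obtain j where "j < q" "D = degree (N $$ (i, j))" using i N by auto
  then show "D \<in> {degree (N $$ (i, j)) |i j. i < dim_row N \<and> j < dim_col N}"
    using i N by blast
qed

theorem theorem5p3:
  fixes m n k' t :: nat
    and d :: "nat list"
    and M :: "'a::field poly mat"
    and \<alpha> :: "nat \<Rightarrow> nat"
  assumes "m > 0" and "n > 0"
    and "length d = m" and "Max (set d) > 0"
    and "M \<in> poly_mat_space d m (m + n)"
    and "\<And>k. \<alpha> k = count_list (right_minimal_indices M) k"
    and "k' = nat \<lceil>real (sum_list d) / real n\<rceil>"
    and "n * k' = sum_list d + t"
  shows
    "(full_trimmed_sylvester_rank d M \<longleftrightarrow>
        \<alpha> (k' - 1) = t \<and> \<alpha> k' = n - t \<and> (\<forall>j. j \<notin> {k' - 1, k'} \<longrightarrow> \<alpha> j = 0))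
     \<and> (full_trimmed_sylvester_rank d M \<longrightarrow>
        is_minimal_basis M
        \<and> vec_space.rank m (leading_row_coeff_mat d M) = m
        \<and> (\<forall>i<m. poly_vec_degree (row M i) = d ! i))
     \<and> (full_trimmed_sylvester_rank d M \<longrightarrow>
        (\<forall>N. dual_minimal_bases M N \<longrightarrow> poly_mat_degree N = k'))"
proof -
  let ?q = "m + n" and ?\<sigma> = "sum_list d"
  let ?K = "mat_kernel (rat_mat M)"
  note m = assms(1) and n = assms(2) and d = assms(3) and M = assms(5) and t = assms(8)
  have tn: "t < n" by (rule ceiling_quotient_remainder[OF n assms(7) t])
  have "Max (set d) \<in> set d" using d m by (intro Max_in) auto
  then have "0 < ?\<sigma>" using member_le_sum_list[of "Max (set d)" d] assms(4) by linarith
  \<comment> \<open>Ensures that \<open>k' - 1\<close> is the true predecessor.\<close>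
  then have k': "0 < k'" using t by (intro gr0I) (simp del: sum_list_eq_0_iff)
  have Mc: "M \<in> carrier_mat m ?q" and dims: "dim_row M = m" "dim_col M = ?q"
    using M by (auto simp: poly_mat_space_def)
  have R: "rat_mat M \<in> carrier_mat m ?q" using Mc by simp
  \<comment> \<open>Stated for an arbitrary minimal basis of the kernel: it serves for the chosen
    one behind \<open>\<alpha>\<close> and for the rows of a dual basis.\<close>
  have iff: "full_trimmed_sylvester_rank d M \<longleftrightarrow>
      count_list (map poly_vec_degree bs) (k' - 1) = t \<and> count_list (map poly_vec_degree bs) k' = n - t \<and>
      (\<forall>j. j \<notin> {k' - 1, k'} \<longrightarrow> count_list (map poly_vec_degree bs) j = 0)"
    if "is_minimal_basis_of ?q ?K bs" for bs
    unfolding full_trimmed_sylvester_rank_iff[OF M d m that] by (rule sum_list_truncated_iff[OF t tn k'])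
  define bs where "bs = (SOME bs. is_minimal_basis_of ?q ?K bs)"
  have bs: "is_minimal_basis_of ?q ?K bs"
    unfolding bs_def using minimal_basis_of_kernel_exists[OF Mc] by (rule someI_ex)
  have \<alpha>: "\<alpha> k = count_list (map poly_vec_degree bs) k" for k
    unfolding assms(6) right_minimal_indices_def minimal_indices_def dims bs_def[symmetric]
    by (rule count_list_sort)
  have a: "full_trimmed_sylvester_rank d M \<longleftrightarrow>
      \<alpha> (k' - 1) = t \<and> \<alpha> k' = n - t \<and> (\<forall>j. j \<notin> {k' - 1, k'} \<longrightarrow> \<alpha> j = 0)"
    unfolding \<alpha> by (rule iff[OF bs])
  have pbs: "is_poly_basis ?q ?K bs" using bs by (simp add: is_minimal_basis_of_def)
  have len: "length bs = n" if "full_trimmed_sylvester_rank d M"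
  proof -
    have c: "count_list (map poly_vec_degree bs) (k' - 1) = t"
      "count_list (map poly_vec_degree bs) k' = n - t"
      "\<And>j. j \<notin> {k' - 1, k'} \<Longrightarrow> count_list (map poly_vec_degree bs) j = 0"
      using iff[OF bs] that by blast+
    then have "set (map poly_vec_degree bs) \<subseteq> {k' - 1, k'}" by (metis count_list_0_iff subsetI)
    from sum_list_map_eq_sum_count2[OF this, of "\<lambda>_. 1"] show ?thesis
      using c(1,2) tn k' by (simp add: o_def sum_list_triv)
  qed
  have b: "is_minimal_basis M \<and> vec_space.rank m (leading_row_coeff_mat d M) = m
      \<and> (\<forall>i<m. poly_vec_degree (row M i) = d ! i)" if F: "full_trimmed_sylvester_rank d M"
  proof -
    \<comment> \<open>At \<open>k'\<close> the trimmed matrix has at most as many rows as columns,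
      so its full rank is full row rank and k' n - \<sigma> is not truncated.\<close>
    have "?\<sigma> \<le> k' * n" using t by (simp add: mult.commute)
    moreover have "vec_space.rank (k' * m + ?\<sigma>) (trimmed_sylvester_mat d k' M)
        = min (k' * m + ?\<sigma>) (k' * ?q)"
      using F k' unfolding full_trimmed_sylvester_rank_def dims by simp
    ultimately have "vec_space.rank (k' * m + ?\<sigma>) (trimmed_sylvester_mat d k' M) = k' * m + ?\<sigma>"
      by (simp add: add_mult_distrib2)
    then have lead: "vec_space.rank m (leading_row_coeff_mat d M) = m"
      by (rule rank_leading_row_coeff_mat[OF M d k'])
    have degs: "poly_vec_degree (row M i) = d ! i" if "i < m" for i
      by (rule row_degree_of_leading_rank[OF M lead that])
    have surj: "\<forall>y\<in>carrier_vec m. \<exists>x\<in>carrier_vec ?q. rat_mat M *\<^sub>v x = y"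
      using rank_rat_mat_of_kernel_basis[OF Mc pbs len[OF F]] unfolding vec_space.rank_eq_nr_iff[OF R] .
    have "sum_list (map (\<lambda>e. k' - e) (map poly_vec_degree bs)) = k' * n - ?\<sigma>"
      using F k' unfolding full_trimmed_sylvester_rank_iff[OF M d m bs] by simp
    then have h: "sum_list (map (\<lambda>e. k' - e) (map poly_vec_degree bs)) + ?\<sigma> = k' * n"
      using \<open>?\<sigma> \<le> k' * n\<close> by simp
    have "map poly_vec_degree (rows M) = d"
      using degs d dims by (intro nth_equalityI) simp_all
    then have "is_minimal_basis_of ?q (vec_space.row_space ?q (rat_mat M)) (rows M)"
      using row_degree_sum_lower_bound[OF Mc m surj bs k' h] surj_rows_poly_basis[OF Mc surj]
      unfolding is_minimal_basis_of_def by simp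
    then show ?thesis using lead degs n dims by (simp add: is_minimal_basis_def)
  qed
  have c: "poly_mat_degree N = k'" if F: "full_trimmed_sylvester_rank d M" and dual: "dual_minimal_bases M N" for N
  proof -
    have Nc: "N \<in> carrier_mat n ?q" using dual dims by (auto simp: dual_minimal_bases_def)
    have "is_minimal_basis_of ?q ?K (rows N)"
      by (rule dual_rows_minimal_basis_of_kernel[OF Mc pbs len[OF F] dual])
    from iff[OF this] F have cN: "count_list (map poly_vec_degree (rows N)) k' = n - t"
      "\<And>j. j \<notin> {k' - 1, k'} \<Longrightarrow> count_list (map poly_vec_degree (rows N)) j = 0"
      by blast+
    have "set (map poly_vec_degree (rows N)) \<subseteq> {k' - 1, k'}" using cN(2) by (metis count_list_0_iff subsetI)
    \<comment> \<open>As t < n, the index \<open>k'\<close> has positive multiplicity n - t, so the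
      upper bound \<open>k'\<close> on the degrees is attained.\<close>
    moreover have "k' \<in> set (map poly_vec_degree (rows N))" using cN(1) tn by (metis count_list_0_iff zero_less_diff less_irrefl)
    ultimately show ?thesis
      using m by (intro poly_mat_degree_eqI[OF Nc]) auto
  qed
  from a b c show ?thesis by blast
qed

end
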